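(* Let $p$ be an odd prime and $d$ a positive integer with $p^d \geqslant 7$, and let $n = p^d$. Let $G$ be $S_n$ or $A_n$ and $H = \mathrm{AGL}_d(p) \cap G$. If $d = 1$, then $\mathrm{I}(G,H) = 1 + \Omega(p-1) + \varepsilon(G)$. If $d \geqslant 2$ and $p \in \{3,5\}$, then \[ \frac{d(d+1)}{2} + d - 1 + \varepsilon(G) \leqslant \mathrm{I}(G,H) < \frac{d(d+1)}{2}(1+\log p) + \varepsilon(G). \] If $d \geqslant 2$ and $p \geqslant 7$, then \[ \frac{d(d+1)}{2} + d\,\Omega(p-1) - 1 + \varepsilon(G) \leqslant \mathrm{I}(G,H) < \frac{d(d+1)}{2}(1+\log p) + \varepsilon(G). \]
   Context: $\mathrm{AGL}_d(p)$ is viewed as a subgroup of $S_{p^d}$ via its action on $\mathbb{F}_p^d$. $\mathrm{I}(G,H)$ denotes the maximum size of an irredundant base for the action of $G$ on the right cosets of $H$; an irredundant base is a sequence $(\gamma_1,\ldots,\gamma_l)$ of points with $G > G_{\gamma_1} > G_{\gamma_1,\gamma_2} > \cdots > G_{\gamma_1,\ldots,\gamma_l} = 1$. $\Omega(k)$ is the number of prime factors of $k$ counted with multiplicity. $\varepsilon(G)$ is the length (maximum length of a strictly descending chain of subgroups) of $G/\mathrm{soc}(G)$; thus $\varepsilon(S_n) = 1$ and $\varepsilon(A_n) = 0$ here. Logarithms are to base $2$. *)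

theory Defs
  imports Complex_Main "HOL-Combinatorics.Permutations" "HOL-Computational_Algebra.Primes"
begin

text \<open>The vector space F_p^d, realised as functions nat => nat supported on {0..<d}
  with values in {0..<p}.\<close>
definition Vec :: "nat \<Rightarrow> nat \<Rightarrow> (nat \<Rightarrow> nat) set" where
  "Vec p d = {x. (\<forall>i<d. x i < p) \<and> (\<forall>i\<ge>d. x i = 0)}"

definition Sym :: "'a set \<Rightarrow> ('a \<Rightarrow> 'a) set" where
  "Sym V = {f. f permutes V}"

definition Alt :: "'a set \<Rightarrow> ('a \<Rightarrow> 'a) set" where
  "Alt V = {f. f permutes V \<and> evenperm f}"

definition AGL :: "nat \<Rightarrow> nat \<Rightarrow> ((nat \<Rightarrow> nat) \<Rightarrow> (nat \<Rightarrow> nat)) set" where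
  "AGL d p = {f. f permutes Vec p d \<and>
     (\<exists>(A :: nat \<Rightarrow> nat \<Rightarrow> nat) (b :: nat \<Rightarrow> nat). \<forall>x\<in>Vec p d.
        f x = (\<lambda>i. if i < d then ((\<Sum>j<d. A i j * x j) + b i) mod p else 0))}"

text \<open>Right cosets H g (group product g*h := g \<circ> h) and the right action of G on them.\<close>
definition rcos :: "('a \<Rightarrow> 'a) set \<Rightarrow> ('a \<Rightarrow> 'a) \<Rightarrow> ('a \<Rightarrow> 'a) set" where
  "rcos H g = (\<lambda>h. h \<circ> g) ` H"

definition cos_act :: "('a \<Rightarrow> 'a) set \<Rightarrow> ('a \<Rightarrow> 'a) \<Rightarrow> ('a \<Rightarrow> 'a) set" where
  "cos_act C x = (\<lambda>y. y \<circ> x) ` C"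

definition cosets :: "('a \<Rightarrow> 'a) set \<Rightarrow> ('a \<Rightarrow> 'a) set \<Rightarrow> ('a \<Rightarrow> 'a) set set" where
  "cosets G H = rcos H ` G"

definition pstab :: "('a \<Rightarrow> 'a) set \<Rightarrow> ('a \<Rightarrow> 'a) set list \<Rightarrow> ('a \<Rightarrow> 'a) set" where
  "pstab G cs = {x\<in>G. \<forall>c\<in>set cs. cos_act c x = c}"

definition irredundant_base ::
  "('a \<Rightarrow> 'a) set \<Rightarrow> ('a \<Rightarrow> 'a) set \<Rightarrow> ('a \<Rightarrow> 'a) set list \<Rightarrow> bool" where
  "irredundant_base G H cs \<longleftrightarrow> set cs \<subseteq> cosets G H \<and>
     (\<forall>i<length cs. pstab G (take (Suc i) cs) \<subset> pstab G (take i cs)) \<and>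
     pstab G cs = {id}"

definition I_base :: "('a \<Rightarrow> 'a) set \<Rightarrow> ('a \<Rightarrow> 'a) set \<Rightarrow> nat" where
  "I_base G H = Max {length cs | cs. irredundant_base G H cs}"

definition bigOmega :: "nat \<Rightarrow> nat" where
  "bigOmega k = size (prime_factorization k)"

end

theory Submission
  imports Defs "HOL-Number_Theory.Pocklington" "HOL-Combinatorics.Cycles"
begin

unbundle no m_inv_syntax

text \<open>An irredundant base is a strictly descending chain of intersections of conjugates of
  AGL_d(p) (met with G), starting at G and ending at the trivial group.

  Upper bounds: by Lagrange, a chain of subgroups below a group X has at most
  \<open>\<Omega>(|X|)\<close> steps, and \<open>|AGL_d(p)| = p^d \<Prod>\<^sub>k (p^d - p^k)\<close>.

  Lower bounds: a nontrivial affine map moves at least \<open>p^d - p^(d-1)\<close> points. Hence, if g moves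
  fewer than half as many, the commutator of g with an affine map f can only be affine if it is
  trivial, so that AGL meets its g-conjugate in the centraliser of g. Taking for g the negation on
  a coordinate subspace (extended by the identity), one descends from AGL through stabilisers of
  coordinate subspaces to the diagonal group, killing one matrix entry at a time. The diagonal
  group is then cut down one coordinate and one prime factor of p - 1 at a time, with g multiplying
  the k-th roots of unity on a coordinate axis by an element of order k if \<open>k \<ge> 3\<close>, and g a
  transposition on that axis if \<open>k \<le> 2\<close>. For d = 1 the first step, from AGL to the diagonal group, uses \<open>x \<mapsto> x\<^sup>-\<^sup>1\<close>.

  Since AGL contains an odd permutation, intersecting a chain for the symmetric group with the
  alternating group makes at most one step collapse.\<close>

section \<open>Chains of stabilisers in permutation groups\<close>

text \<open>The obstacle is to know exactly which affine maps stay affine after conjugation by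
  \<open>g\<close>. The commutator criterion answers this only for \<open>g\<close> of small
  support, and that shapes the choices. Negation on a proper coordinate subspace moves at most
  \<open>p ^ (d - 1) - 1\<close> points, few enough for every odd \<open>p\<close>. A transposition
  is admissible once \<open>p ^ d - p ^ (d - 1) > 4\<close>, which is what
  \<open>p ^ d \<ge> 7\<close> provides. Multiplication on the \<open>k\<close>-th roots of unity
  moves up to \<open>p - 1\<close> points, too many if \<open>d = 1\<close>; it is treated by a
  direct computation that forces the multiplier to satisfy \<open>c ^ 2 = 1\<close>, a contradiction
  only for \<open>k \<ge> 3\<close>. On a line there is no proper nonzero subspace to negate on,
  whence inversion. Its support is not small either, but there the diagonal group has prime index
  \<open>p\<close> in the affine group, so a single affine map that inversion does not conjugate to
  an affine map determines the intersection.\<close>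

lemma card_eq_card_image_times_fibre:
  assumes "finite X" "\<And>y. y \<in> \<phi> ` X \<Longrightarrow> card {x\<in>X. \<phi> x = y} = m"
  shows "card X = card (\<phi> ` X) * m"
proof -
  have "card X = (\<Sum>y\<in>\<phi> ` X. card {x\<in>X. \<phi> x = y})"
    using sum.image_gen[OF assms(1), of "\<lambda>_. 1::nat" \<phi>] by simp
  also have "\<dots> = card (\<phi> ` X) * m" using assms(2) by simp
  finally show ?thesis .
qed

section \<open>Prime factors counted with multiplicity\<close>

lemma bigOmega_mult: "a \<noteq> 0 \<Longrightarrow> b \<noteq> 0 \<Longrightarrow> bigOmega (a * b) = bigOmega a + bigOmega b"
  unfolding bigOmega_def by (simp add: prime_factorization_mult)

lemma bigOmega_prime: "prime p \<Longrightarrow> bigOmega p = 1"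
  unfolding bigOmega_def by (simp add: prime_factorization_prime)

lemma bigOmega_1 [simp]: "bigOmega 1 = 0" "bigOmega (Suc 0) = 0"
  unfolding bigOmega_def by simp_all

lemma bigOmega_pos:
  assumes "n > 1" shows "bigOmega n > 0"
proof -
  obtain q where q: "prime q" "q dvd n" using assms prime_factor_nat by (metis less_irrefl)
  then have "q \<in># prime_factorization n" using assms by (auto simp: in_prime_factors_iff)
  then show ?thesis unfolding bigOmega_def by (metis size_eq_0_iff_empty empty_not_add_mset insert_DiffM gr0I)
qed

lemma bigOmega_power: "prime p \<Longrightarrow> bigOmega (p ^ n) = n"
  by (induction n) (auto simp: bigOmega_mult bigOmega_prime)

lemma bigOmega_prod:
  assumes "finite A" "\<And>x. x \<in> A \<Longrightarrow> f x \<noteq> 0"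
  shows "bigOmega (\<Prod>x\<in>A. f x) = (\<Sum>x\<in>A. bigOmega (f x))"
  using assms by (induction A) (auto simp: bigOmega_mult)

text \<open>With Lagrange's theorem, every strict inclusion of finite groups costs at least one
  prime factor of the order.\<close>

lemma bigOmega_mono_strict:
  assumes "a dvd b" "a \<noteq> b" "b > 0"
  shows "bigOmega a < bigOmega b"
proof -
  obtain c where c: "b = a * c" using assms(1) by blast
  then have "c > 1" "a > 0" using assms by (auto intro: Nat.gr0I simp: nat_neq_iff)
  then show ?thesis using c bigOmega_pos[of c] by (simp add: bigOmega_mult)
qed

text \<open>Each prime factor is at least 2. This is the source of the logarithm in the upper
  bound.\<close>

lemma two_power_bigOmega_le:
  assumes "n > 0" shows "2 ^ bigOmega n \<le> n"
  using assms
proof (induction n rule: less_induct)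
  case (less n)
  show ?case
  proof (cases "n = 1")
    case False
    obtain q where q: "prime q" "q dvd n" using False prime_factor_nat by blast
    then obtain c where c: "n = q * c" by blast
    have q2: "q \<ge> 2" using q prime_ge_2_nat by blast
    have c0: "c > 0" using less.prems c by (auto intro: Nat.gr0I)
    have "c < n" using c c0 q2 by simp
    then have "2 ^ bigOmega c \<le> c" using less.IH c0 by blast
    then have "2 * 2 ^ bigOmega c \<le> q * c" using q2 mult_le_mono by blast
    moreover have "bigOmega n = Suc (bigOmega c)"
      using c c0 q by (simp add: bigOmega_mult bigOmega_prime)
    ultimately show ?thesis using c by simp
  qed simp
qed

section \<open>Permutation groups: Lagrange, orbits and conjugates\<close>

definition perm_group :: "'a set \<Rightarrow> ('a \<Rightarrow> 'a) set \<Rightarrow> bool" where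
  "perm_group V X \<longleftrightarrow> X \<subseteq> Sym V \<and> id \<in> X \<and>
     (\<forall>f\<in>X. \<forall>g\<in>X. f \<circ> g \<in> X) \<and> (\<forall>f\<in>X. inv f \<in> X)"

lemma perm_groupD:
  assumes "perm_group V X"
  shows "f \<in> X \<Longrightarrow> f permutes V" "id \<in> X" "f \<in> X \<Longrightarrow> g \<in> X \<Longrightarrow> f \<circ> g \<in> X"
    "f \<in> X \<Longrightarrow> inv f \<in> X"
  using assms unfolding perm_group_def Sym_def by auto

lemma finite_Sym: "finite V \<Longrightarrow> finite (Sym V)"
  unfolding Sym_def by (rule finite_permutations)

lemma perm_group_finite: "finite V \<Longrightarrow> perm_group V X \<Longrightarrow> finite X"
  unfolding perm_group_def using finite_Sym finite_subset by metis

lemma perm_group_Sym: "perm_group V (Sym V)"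
  unfolding perm_group_def Sym_def by (auto intro: permutes_compose permutes_inv permutes_id)

lemma perm_group_Alt:
  assumes "finite V" shows "perm_group V (Alt V)"
  unfolding perm_group_def Sym_def Alt_def
  using permutes_imp_permutation[OF assms]
  by (auto intro: permutes_compose permutes_inv permutes_id simp: evenperm_comp evenperm_inv)

lemma perm_group_Int: "perm_group V X \<Longrightarrow> perm_group V Y \<Longrightarrow> perm_group V (X \<inter> Y)"
  unfolding perm_group_def by auto

lemma perm_comp_cancel:
  assumes "f permutes V"
  shows "inv f \<circ> (f \<circ> g) = g" "f \<circ> (inv f \<circ> g) = g" "(g \<circ> f) \<circ> inv f = g" "(g \<circ> inv f) \<circ> f = g"
  using permutes_inv_o[OF assms] by (simp_all add: fun_eq_iff permutes_inverses[OF assms])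

lemma perm_group_fixing:
  assumes "perm_group U X" shows "perm_group U {f\<in>X. \<forall>x\<in>F. f x = x}"
  unfolding perm_group_def
proof (intro conjI ballI)
  fix f assume f: "f \<in> {f\<in>X. \<forall>x\<in>F. f x = x}"
  then have "inv f x = x" if "x \<in> F" for x
    using permutes_inv_eq[OF perm_groupD(1)[OF assms], of f] that by simp
  then show "inv f \<in> {f\<in>X. \<forall>x\<in>F. f x = x}" using f perm_groupD(4)[OF assms] by blast
qed (use perm_groupD[OF assms] assms in \<open>auto simp: perm_group_def\<close>)

lemma perm_group_lagrange:
  assumes "finite V" "perm_group V X" "perm_group V Y" "Y \<subseteq> X"
  shows "card Y dvd card X"
proof -
  have fin: "finite X" using assms perm_group_finite by blast
  \<comment> \<open>\<open>\<phi> x\<close> is the left coset of \<open>x\<close>; the fibres of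
    \<open>\<phi>\<close> are the cosets themselves, all of the size of \<open>Y\<close>.\<close>
  define \<phi> where "\<phi> x = (\<lambda>y. x \<circ> y) ` Y" for x :: "'a \<Rightarrow> 'a"
  have fib: "{x\<in>X. \<phi> x = \<phi> z} = (\<lambda>y. z \<circ> y) ` Y" if z: "z \<in> X" for z
  proof (intro equalityI subsetI)
    fix x assume x: "x \<in> {x\<in>X. \<phi> x = \<phi> z}"
    have "x \<circ> id \<in> \<phi> x" unfolding \<phi>_def using perm_groupD(2)[OF assms(3)] by blast
    then show "x \<in> (\<lambda>y. z \<circ> y) ` Y" using x unfolding \<phi>_def by auto
  next
    fix x assume "x \<in> (\<lambda>y. z \<circ> y) ` Y"
    then obtain y where y: "y \<in> Y" "x = z \<circ> y" by blast
    have yp: "y permutes V" using perm_groupD(1)[OF assms(3)] y by blast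
    have "\<phi> x = \<phi> z"
    proof (intro equalityI subsetI)
      fix u assume "u \<in> \<phi> x"
      then obtain w where "w \<in> Y" "u = z \<circ> (y \<circ> w)" unfolding \<phi>_def y(2) by (auto simp: comp_assoc)
      then show "u \<in> \<phi> z" unfolding \<phi>_def using perm_groupD(3)[OF assms(3)] y by blast
    next
      fix u assume "u \<in> \<phi> z"
      then obtain w where w: "w \<in> Y" "u = z \<circ> w" unfolding \<phi>_def by blast
      have "u = x \<circ> (inv y \<circ> w)" unfolding w y
        using perm_comp_cancel(2)[OF yp] by (simp add: comp_assoc)
      then show "u \<in> \<phi> x" unfolding \<phi>_def
        using perm_groupD(3,4)[OF assms(3)] y w by blast
    qed
    then show "x \<in> {x\<in>X. \<phi> x = \<phi> z}" using y z assms(4) perm_groupD(3)[OF assms(2)] by blast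
  qed
  have "card X = card (\<phi> ` X) * card Y"
  proof (rule card_eq_card_image_times_fibre[OF fin])
    fix u assume "u \<in> \<phi> ` X"
    then obtain z where z: "z \<in> X" "u = \<phi> z" by blast
    have "inj_on (\<lambda>y. z \<circ> y) Y"
      by (rule inj_on_inverseI[where g="\<lambda>y. inv z \<circ> y"])
        (use perm_comp_cancel(1) perm_groupD(1)[OF assms(2)] z in blast)
    then show "card {x\<in>X. \<phi> x = u} = card Y" using fib[OF z(1)] z(2) by (simp add: card_image)
  qed
  then show ?thesis by simp
qed

lemma perm_group_orbit_stabiliser:
  assumes "finite V" "perm_group V X"
  shows "card X = card ((\<lambda>f. f v) ` X) * card {f\<in>X. f v = v}"
proof (rule card_eq_card_image_times_fibre)
  show "finite X" using assms perm_group_finite by blast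
  fix u assume "u \<in> (\<lambda>f. f v) ` X"
  then obtain z where z: "z \<in> X" "u = z v" by blast
  note zp = perm_groupD(1)[OF assms(2) z(1)]
  have "{f\<in>X. f v = u} = (\<lambda>y. z \<circ> y) ` {f\<in>X. f v = v}"
  proof (intro equalityI subsetI)
    fix f assume f: "f \<in> {f\<in>X. f v = u}"
    have "f = z \<circ> (inv z \<circ> f)" using perm_comp_cancel(2)[OF zp] by simp
    moreover have "inv z \<circ> f \<in> {f\<in>X. f v = v}"
      using f z perm_groupD(3,4)[OF assms(2)] permutes_inverses[OF zp] by simp
    ultimately show "f \<in> (\<lambda>y. z \<circ> y) ` {f\<in>X. f v = v}" by blast
  qed (use z perm_groupD(3)[OF assms(2)] in auto)
  moreover have "inj_on (\<lambda>y. z \<circ> y) {f\<in>X. f v = v}"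
    by (rule inj_on_inverseI[where g="\<lambda>y. inv z \<circ> y"]) (use perm_comp_cancel(1)[OF zp] in blast)
  ultimately show "card {f\<in>X. f v = u} = card {f\<in>X. f v = v}" by (simp add: card_image)
qed

text \<open>The conjugate of H by the inverse of g, which is the stabiliser of the right coset H g.\<close>
definition conj_stab :: "'a set \<Rightarrow> ('a \<Rightarrow> 'a) set \<Rightarrow> ('a \<Rightarrow> 'a) \<Rightarrow> ('a \<Rightarrow> 'a) set" where
  "conj_stab V H g = {x \<in> Sym V. g \<circ> x \<circ> inv g \<in> H}"

lemma perm_group_conj_stab:
  assumes "perm_group V H" "g permutes V"
  shows "perm_group V (conj_stab V H g)"
proof -
  have b: "bij g" using assms(2) permutes_bij by blast
  have c: "g \<circ> (x \<circ> y) \<circ> inv g = (g \<circ> x \<circ> inv g) \<circ> (g \<circ> y \<circ> inv g)" for x y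
    using permutes_inverses[OF assms(2)] by (simp add: fun_eq_iff)
  have i: "g \<circ> inv x \<circ> inv g = inv (g \<circ> x \<circ> inv g)" if "x permutes V" for x
  proof -
    have "bij x" using that permutes_bij by blast
    then show ?thesis using b
      by (simp add: o_inv_distrib bij_comp bij_imp_bij_inv inv_inv_eq comp_assoc)
  qed
  have e: "g \<circ> id \<circ> inv g = id" using permutes_inv_o[OF assms(2)] by simp
  show ?thesis unfolding perm_group_def
  proof (intro conjI ballI)
    show "conj_stab V H g \<subseteq> Sym V" unfolding conj_stab_def by blast
    show "id \<in> conj_stab V H g" using perm_groupD(2)[OF assms(1)] e
      unfolding conj_stab_def Sym_def by (auto intro: permutes_id)
  next
    fix x y assume "x \<in> conj_stab V H g" "y \<in> conj_stab V H g"
    then show "x \<circ> y \<in> conj_stab V H g" unfolding conj_stab_def Sym_def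
      using c[of x y] perm_groupD(3)[OF assms(1)] permutes_compose[of y V x] by simp
  next
    fix x assume "x \<in> conj_stab V H g"
    then show "inv x \<in> conj_stab V H g" unfolding conj_stab_def Sym_def
      using i[of x] perm_groupD(4)[OF assms(1)] permutes_inv[of x V] by simp
  qed
qed

lemma conj_stab_id: "perm_group V H \<Longrightarrow> conj_stab V H id = H"
  unfolding conj_stab_def using perm_groupD(1) by (auto simp: Sym_def)

text \<open>\<open>h \<circ> g\<close> represents the same right coset as \<open>g\<close>. With an
  odd \<open>h\<close> this freedom changes the sign of a representative.\<close>

lemma conj_stab_comp_left:
  assumes "perm_group V H" "h \<in> H" "g permutes V"
  shows "conj_stab V H (h \<circ> g) = conj_stab V H g"
proof -
  note hp = perm_groupD(1)[OF assms(1,2)]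
  have e: "(h \<circ> g) \<circ> x \<circ> inv (h \<circ> g) = h \<circ> (g \<circ> x \<circ> inv g) \<circ> inv h" for x
    using permutes_bij[OF hp] permutes_bij[OF assms(3)] by (simp add: o_inv_distrib comp_assoc)
  have "h \<circ> y \<circ> inv h \<in> H \<longleftrightarrow> y \<in> H" for y
  proof
    assume "h \<circ> y \<circ> inv h \<in> H"
    then have "inv h \<circ> (h \<circ> y \<circ> inv h) \<circ> h \<in> H"
      using perm_groupD(3,4)[OF assms(1)] assms(2) by blast
    then show "y \<in> H" by (simp add: comp_assoc permutes_inv_o[OF hp] perm_comp_cancel[OF hp])
  qed (use perm_groupD(3,4)[OF assms(1)] assms(2) in blast)
  then show ?thesis unfolding conj_stab_def e by blast
qed

lemma card_conj_stab:
  assumes "perm_group V H" "g permutes V"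
  shows "card (conj_stab V H g) = card H"
proof (rule bij_betw_same_card)
  show "bij_betw (\<lambda>x. g \<circ> x \<circ> inv g) (conj_stab V H g) H"
  proof (rule bij_betw_byWitness[where f'="\<lambda>x. inv g \<circ> x \<circ> g"])
    show "(\<lambda>x. inv g \<circ> x \<circ> g) ` H \<subseteq> conj_stab V H g"
    proof
      fix y assume "y \<in> (\<lambda>x. inv g \<circ> x \<circ> g) ` H"
      then obtain x where x: "x \<in> H" "y = inv g \<circ> x \<circ> g" by blast
      have "g \<circ> y \<circ> inv g = x" using permutes_inverses[OF assms(2)] by (simp add: x fun_eq_iff)
      moreover have "y permutes V" unfolding x
        by (intro permutes_compose assms permutes_inv perm_groupD(1)[OF assms(1)] x)
      ultimately show "y \<in> conj_stab V H g" using x unfolding conj_stab_def Sym_def by simp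
    qed
  qed (use permutes_inverses[OF assms(2)] in \<open>auto simp: fun_eq_iff conj_stab_def\<close>)
qed

section \<open>Irredundant bases as chains of stabilisers\<close>

definition base_step ::
  "'a set \<Rightarrow> ('a \<Rightarrow> 'a) set \<Rightarrow> ('a \<Rightarrow> 'a) set \<Rightarrow> ('a \<Rightarrow> 'a) set \<Rightarrow> ('a \<Rightarrow> 'a) set \<Rightarrow> bool" where
  "base_step V H G X Y \<longleftrightarrow> (\<exists>g\<in>G. Y = X \<inter> conj_stab V H g \<and> Y \<subset> X)"

lemma rcos_fixed_iff:
  assumes "perm_group V H" "g permutes V" "x permutes V"
  shows "cos_act (rcos H g) x = rcos H g \<longleftrightarrow> g \<circ> x \<circ> inv g \<in> H"
proof
  assume "cos_act (rcos H g) x = rcos H g"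
  moreover have "(id \<circ> g) \<circ> x \<in> cos_act (rcos H g) x"
    unfolding cos_act_def rcos_def using perm_groupD(2)[OF assms(1)] by blast
  ultimately obtain h where h: "h \<in> H" "g \<circ> x = h \<circ> g" unfolding rcos_def by auto
  then show "g \<circ> x \<circ> inv g \<in> H" using perm_comp_cancel(3)[OF assms(2)] by simp
next
  assume k: "g \<circ> x \<circ> inv g \<in> H"
  define k where "k = g \<circ> x \<circ> inv g"
  have kH: "k \<in> H" using k k_def by simp
  have kp: "k permutes V" using perm_groupD(1)[OF assms(1) kH] .
  have gx: "g \<circ> x = k \<circ> g" unfolding k_def using perm_comp_cancel(4)[OF assms(2)] by simp
  show "cos_act (rcos H g) x = rcos H g"
  proof (intro equalityI subsetI)
    fix y assume "y \<in> cos_act (rcos H g) x"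
    then obtain h where h: "h \<in> H" "y = h \<circ> (g \<circ> x)" unfolding cos_act_def rcos_def by (auto simp: comp_assoc)
    then have "y = (h \<circ> k) \<circ> g" by (simp add: gx comp_assoc)
    then show "y \<in> rcos H g" unfolding rcos_def using h kH perm_groupD(3)[OF assms(1)] by blast
  next
    fix y assume "y \<in> rcos H g"
    then obtain h where h: "h \<in> H" "y = h \<circ> g" unfolding rcos_def by blast
    have "y = (h \<circ> inv k) \<circ> (k \<circ> g)" using permutes_inverses[OF kp] by (simp add: h fun_eq_iff)
    then have "y = ((h \<circ> inv k) \<circ> g) \<circ> x" by (simp only: gx[symmetric] comp_assoc)
    moreover have "h \<circ> inv k \<in> H" using h kH perm_groupD(3,4)[OF assms(1)] by blast
    ultimately show "y \<in> cos_act (rcos H g) x" unfolding cos_act_def rcos_def by blast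
  qed
qed

lemma pstab_Cons: "pstab G (c # cs) = pstab (pstab G [c]) cs"
  unfolding pstab_def by auto

lemma pstab_Nil [simp]: "pstab G [] = G"
  unfolding pstab_def by auto

text \<open>Conjugation by \<open>g \<in> G\<close> keeps elements of \<open>G\<close> in
  \<open>G\<close>, so lying in \<open>H \<inter> G\<close> or in \<open>H\<close> is the same
  condition afterwards. Hence chains can be described with the full group \<open>H\<close>, for the
  symmetric and the alternating group alike.\<close>

lemma pstab_rcos:
  assumes "perm_group V H" "perm_group V G" "X \<subseteq> G" "g \<in> G"
  shows "pstab X [rcos (H \<inter> G) g] = X \<inter> conj_stab V H g"
proof -
  have "cos_act (rcos (H \<inter> G) g) x = rcos (H \<inter> G) g \<longleftrightarrow> x \<in> conj_stab V H g" if "x \<in> X" for x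
  proof -
    have x: "x \<in> G" using that assms(3) by blast
    have "g \<circ> x \<circ> inv g \<in> G" using x assms(4) perm_groupD(3,4)[OF assms(2)] by blast
    moreover have "x \<in> Sym V" using x perm_groupD(1)[OF assms(2)] unfolding Sym_def by blast
    ultimately show ?thesis
      using rcos_fixed_iff[OF perm_group_Int[OF assms(1,2)], of g x] x assms(4) perm_groupD(1)[OF assms(2)]
      unfolding conj_stab_def by auto
  qed
  then show ?thesis unfolding pstab_def by auto
qed

text \<open>The first point of a base replaces the acting group by a stabiliser and the remaining
  points go on from there, so the induction runs over an arbitrary start \<open>X\<close>. In
  relational form chains are joined by composition, without handling lists of cosets.\<close>

lemma relpowp_base_step_iff:
  assumes "perm_group V H" "perm_group V G" "X \<subseteq> G"
  shows "(base_step V H G ^^ n) X Y \<longleftrightarrow>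
    (\<exists>cs. length cs = n \<and> set cs \<subseteq> cosets G (H \<inter> G) \<and>
      (\<forall>i<length cs. pstab X (take (Suc i) cs) \<subset> pstab X (take i cs)) \<and> pstab X cs = Y)"
  using assms(3)
proof (induction n arbitrary: X)
  case 0
  then show ?case by auto
next
  case (Suc n)
  show ?case
  proof
    assume "(base_step V H G ^^ Suc n) X Y"
    from relpowp_Suc_D2[OF this] obtain Z where Z: "base_step V H G X Z" "(base_step V H G ^^ n) Z Y"
      by blast
    from Z(1) obtain g where g: "g \<in> G" "Z = X \<inter> conj_stab V H g" "Z \<subset> X"
      unfolding base_step_def by blast
    define c where "c = rcos (H \<inter> G) g"
    have Zc: "pstab X [c] = Z" unfolding c_def using pstab_rcos[OF assms(1,2) Suc.prems g(1)] g(2) by simp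
    have Pc: "pstab X (c # ds) = pstab Z ds" for ds by (subst pstab_Cons) (simp only: Zc)
    from Suc.IH[of Z] Z(2) Suc.prems g(3) obtain cs where cs: "length cs = n" "set cs \<subseteq> cosets G (H \<inter> G)"
      "\<forall>i<length cs. pstab Z (take (Suc i) cs) \<subset> pstab Z (take i cs)" "pstab Z cs = Y"
      by auto
    have "pstab X (take (Suc i) (c # cs)) \<subset> pstab X (take i (c # cs))" if "i < length (c # cs)" for i
      using that cs(3) g(3) by (cases i) (auto simp: Pc)
    moreover have "c \<in> cosets G (H \<inter> G)" unfolding c_def cosets_def using g by blast
    moreover have "pstab X (c # cs) = Y" using cs by (simp add: Pc)
    ultimately show "\<exists>cs. length cs = Suc n \<and> set cs \<subseteq> cosets G (H \<inter> G) \<and>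
      (\<forall>i<length cs. pstab X (take (Suc i) cs) \<subset> pstab X (take i cs)) \<and> pstab X cs = Y"
      using cs by (intro exI[of _ "c # cs"]) auto
  next
    assume "\<exists>cs. length cs = Suc n \<and> set cs \<subseteq> cosets G (H \<inter> G) \<and>
      (\<forall>i<length cs. pstab X (take (Suc i) cs) \<subset> pstab X (take i cs)) \<and> pstab X cs = Y"
    then obtain ds where ds: "length ds = Suc n" "set ds \<subseteq> cosets G (H \<inter> G)"
      "\<forall>i<length ds. pstab X (take (Suc i) ds) \<subset> pstab X (take i ds)" "pstab X ds = Y"
      by blast
    obtain c cs where "ds = c # cs" using ds(1) by (cases ds) auto
    then have cs: "length cs = n" "set (c # cs) \<subseteq> cosets G (H \<inter> G)"
      "\<forall>i<Suc n. pstab X (take (Suc i) (c # cs)) \<subset> pstab X (take i (c # cs))" "pstab X (c # cs) = Y"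
      using ds by simp_all
    from cs(2) obtain g where g: "g \<in> G" "c = rcos (H \<inter> G) g" unfolding cosets_def by auto
    define Z where "Z = X \<inter> conj_stab V H g"
    have Zc: "pstab X [c] = Z" unfolding Z_def g(2) using pstab_rcos[OF assms(1,2) Suc.prems g(1)] .
    have Pc: "pstab X (c # ds) = pstab Z ds" for ds by (subst pstab_Cons) (simp only: Zc)
    have "Z \<subset> X" using cs(3)[rule_format, of 0] by (simp add: Pc)
    moreover have "pstab Z (take (Suc i) cs) \<subset> pstab Z (take i cs)" if "i < length cs" for i
      using cs(3)[rule_format, of "Suc i"] that cs(1) by (simp add: Pc)
    moreover have "pstab Z cs = Y" using cs(4) by (simp add: Pc)
    ultimately have "(base_step V H G ^^ n) Z Y"
      using Suc.IH[of Z] Suc.prems cs(1,2) by auto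
    moreover have "base_step V H G X Z" unfolding base_step_def using g Z_def \<open>Z \<subset> X\<close> by blast
    ultimately show "(base_step V H G ^^ Suc n) X Y" by (rule relpowp_Suc_I2[rotated])
  qed
qed

lemma I_base_eq_Max_relpowp:
  assumes "perm_group V H" "perm_group V G"
  shows "I_base G (H \<inter> G) = Max {n. (base_step V H G ^^ n) G {id}}"
proof -
  have "{length cs |cs. irredundant_base G (H \<inter> G) cs} = {n. (base_step V H G ^^ n) G {id}}"
    unfolding irredundant_base_def relpowp_base_step_iff[OF assms subset_refl] by blast
  then show ?thesis unfolding I_base_def by simp
qed

section \<open>General bounds for the symmetric and the alternating group\<close>

lemma relpowp_base_step_le_bigOmega:
  assumes "finite V" "perm_group V H" "perm_group V G" "perm_group V X"
    and "(base_step V H G ^^ n) X Y"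
  shows "n \<le> bigOmega (card X)"
  using assms(4,5)
proof (induction n arbitrary: X)
  case (Suc n)
  from relpowp_Suc_D2[OF Suc.prems(2)] obtain Z where Z: "base_step V H G X Z" "(base_step V H G ^^ n) Z Y"
    by blast
  from Z(1) obtain g where g: "g \<in> G" "Z = X \<inter> conj_stab V H g" "Z \<subset> X"
    unfolding base_step_def by blast
  have gZ: "perm_group V Z" unfolding g(2)
    using perm_group_Int perm_group_conj_stab Suc.prems(1) assms(2) perm_groupD(1)[OF assms(3) g(1)] by blast
  have fX: "finite X" using perm_group_finite assms(1) Suc.prems(1) by blast
  have "card Z dvd card X" using perm_group_lagrange assms(1) Suc.prems(1) gZ g(3) by blast
  moreover have "card Z < card X" using g(3) fX psubset_card_mono by blast
  ultimately have "bigOmega (card Z) < bigOmega (card X)" by (intro bigOmega_mono_strict) auto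
  then show ?case using Suc.IH[OF gZ Z(2)] by simp
qed simp

text \<open>The first step lands in a conjugate of \<open>H\<close> met with \<open>G\<close>. For
  the symmetric group this is the whole conjugate, and the first step counts extra. For the
  alternating group the odd element makes it a proper subgroup of the conjugate, and the prime
  factor lost in this way pays for the first step.\<close>

lemma I_base_upper:
  assumes fin: "finite V" and H: "perm_group V H" and G: "G = Sym V \<or> G = Alt V"
    and odd: "h \<in> H" "\<not> evenperm h"
    and st: "(base_step V H G ^^ n) G {id}"
  shows "n \<le> bigOmega (card H) + (if G = Sym V then 1 else 0)"
proof (cases n)
  case (Suc m)
  have pG: "perm_group V G" using G perm_group_Sym perm_group_Alt[OF fin] by blast
  from relpowp_Suc_D2[OF st[unfolded Suc]]
  obtain Z where Z: "base_step V H G G Z" "(base_step V H G ^^ m) Z {id}" by blast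
  from Z(1) obtain g where g: "g \<in> G" "Z = G \<inter> conj_stab V H g" "Z \<subset> G"
    unfolding base_step_def by blast
  have gp: "g permutes V" using perm_groupD(1)[OF pG g(1)] .
  note pK = perm_group_conj_stab[OF H gp]
  have pZ: "perm_group V Z" unfolding g(2) using perm_group_Int[OF pG pK] .
  have le: "m \<le> bigOmega (card Z)" using relpowp_base_step_le_bigOmega[OF fin H pG pZ Z(2)] .
  have cK: "card (conj_stab V H g) = card H" using card_conj_stab[OF H gp] .
  have Hpos: "card H > 0" using perm_group_finite[OF fin H] perm_groupD(2)[OF H] card_gt_0_iff by blast
  show ?thesis
  proof (cases "G = Sym V")
    case True
    have "Z = conj_stab V H g" unfolding g(2) True conj_stab_def by blast
    then show ?thesis using le cK Suc True by simp
  next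
    case False
    then have GA: "G = Alt V" using G by blast
    define k where "k = inv g \<circ> h \<circ> g"
    have hp: "h permutes V" using perm_groupD(1)[OF H odd(1)] .
    have kp: "k permutes V" unfolding k_def by (intro permutes_compose hp gp permutes_inv)
    note per = permutes_imp_permutation[OF fin]
    have "\<not> evenperm k"
      unfolding k_def using odd(2) per[OF hp] per[OF gp] per[OF permutes_inv[OF gp]]
      by (simp add: evenperm_comp evenperm_inv permutation_compose)
    moreover have "g \<circ> k \<circ> inv g = h" unfolding k_def using permutes_inverses[OF gp] by (simp add: fun_eq_iff)
    ultimately have "k \<in> conj_stab V H g" "k \<notin> Z"
      unfolding g(2) GA Alt_def conj_stab_def Sym_def using kp odd by auto
    then have ss: "Z \<subset> conj_stab V H g" unfolding g(2) by blast
    then have "card Z < card (conj_stab V H g)"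
      using psubset_card_mono perm_group_finite[OF fin pK] by blast
    moreover have "card Z dvd card (conj_stab V H g)"
      using perm_group_lagrange[OF fin pK pZ] ss by blast
    ultimately have "bigOmega (card Z) < bigOmega (card H)"
      unfolding cK using bigOmega_mono_strict Hpos by auto
    then show ?thesis using le Suc by simp
  qed
qed simp

text \<open>A step collapses only when a group with odd elements is followed by a group of even
  permutations with the same even part. From then on the chain stays among the even permutations, so
  this happens at most once; the test \<open>X \<subseteq> Alt V\<close> records whether it can
  still happen.\<close>

lemma relpowp_base_step_Alt:
  assumes fin: "finite V" and H: "perm_group V H" and odd: "h \<in> H" "\<not> evenperm h"
    and X: "perm_group V X" and st: "(base_step V H (Sym V) ^^ n) X Y"
  shows "\<exists>m\<ge>(if X \<subseteq> Alt V then n else n - 1). (base_step V H (Alt V) ^^ m) (X \<inter> Alt V) (Y \<inter> Alt V)"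
  using X st
proof (induction n arbitrary: X)
  case 0
  then show ?case by (intro exI[of _ 0]) auto
next
  case (Suc n)
  from relpowp_Suc_D2[OF Suc.prems(2)] obtain Z where Z: "base_step V H (Sym V) X Z" "(base_step V H (Sym V) ^^ n) Z Y"
    by blast
  from Z(1) obtain g where g: "g permutes V" "Z = X \<inter> conj_stab V H g" "Z \<subset> X"
    unfolding base_step_def Sym_def by blast
  note per = permutes_imp_permutation[OF fin]
  note hp = perm_groupD(1)[OF H odd(1)]
  have pZ: "perm_group V Z" unfolding g(2) using perm_group_Int perm_group_conj_stab[OF H g(1)] Suc.prems(1) by blast
  \<comment> \<open>An odd \<open>g\<close> is replaced by the even \<open>h \<circ> g\<close>,
    which represents the same coset.\<close>
  obtain g' where g': "g' \<in> Alt V" "conj_stab V H g' = conj_stab V H g"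
  proof (cases "evenperm g")
    case True
    then show thesis using that[of g] g(1) unfolding Alt_def by simp
  next
    case False
    then have "h \<circ> g \<in> Alt V" unfolding Alt_def
      using permutes_compose[OF g(1) hp] odd evenperm_comp[OF per[OF hp] per[OF g(1)]] by simp
    then show thesis using that conj_stab_comp_left[OF H odd(1) g(1)] by blast
  qed
  from Suc.IH[OF pZ Z(2)] obtain m where m: "m \<ge> (if Z \<subseteq> Alt V then n else n - 1)"
    "(base_step V H (Alt V) ^^ m) (Z \<inter> Alt V) (Y \<inter> Alt V)" by blast
  show ?case
  proof (cases "Z \<inter> Alt V = X \<inter> Alt V")
    case True
    \<comment> \<open>an odd element of Z times an element of X outside Z would be an even element of X outside Z\<close>
    obtain x where x: "x \<in> X" "x \<notin> Z" using g(3) by blast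
    then have xo: "x \<notin> Alt V" using True by blast
    have xp: "x permutes V" using perm_groupD(1)[OF Suc.prems(1)] x by blast
    have xne: "\<not> evenperm x" using xo xp unfolding Alt_def by blast
    have "Z \<subseteq> Alt V"
    proof
      fix y assume y: "y \<in> Z"
      have yp: "y permutes V" using perm_groupD(1)[OF pZ] y by blast
      show "y \<in> Alt V"
      proof (rule ccontr)
        assume "y \<notin> Alt V"
        then have "evenperm (x \<circ> y)" "x \<circ> y permutes V"
          using xne yp evenperm_comp[OF per[OF xp] per[OF yp]] permutes_compose[OF yp xp]
          unfolding Alt_def by auto
        moreover have "x \<circ> y \<in> X" using x y g(3) perm_groupD(3)[OF Suc.prems(1)] by blast
        ultimately have "x \<circ> y \<in> Z" using True unfolding Alt_def by blast
        then have "(x \<circ> y) \<circ> inv y \<in> Z" using y perm_groupD(3,4)[OF pZ] by blast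
        then show False using x perm_comp_cancel(3)[OF yp] by simp
      qed
    qed
    then show ?thesis using m True x xo by (intro exI[of _ m]) auto
  next
    case False
    have "base_step V H (Alt V) (X \<inter> Alt V) (Z \<inter> Alt V)"
      unfolding base_step_def using g' g False by (intro bexI[of _ g']) auto
    then have "(base_step V H (Alt V) ^^ Suc m) (X \<inter> Alt V) (Y \<inter> Alt V)"
      using m(2) relpowp_Suc_I2 by metis
    moreover have "Suc m \<ge> (if X \<subseteq> Alt V then Suc n else Suc n - 1)"
      using m(1) g(3) by (auto split: if_splits)
    ultimately show ?thesis by blast
  qed
qed

lemma I_base_bounds:
  assumes fin: "finite V" and H: "perm_group V H" and G: "G = Sym V \<or> G = Alt V"
    and odd: "h \<in> H" "\<not> evenperm h"
    and st: "(base_step V H (Sym V) ^^ L) (Sym V) {id}"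
    and eps: "eps = (if G = Sym V then 1 else 0)"
  shows "L - 1 + eps \<le> I_base G (H \<inter> G)" "I_base G (H \<inter> G) \<le> bigOmega (card H) + eps"
proof -
  have pG: "perm_group V G" using G perm_group_Sym perm_group_Alt[OF fin] by blast
  let ?S = "{n. (base_step V H G ^^ n) G {id}}"
  have ub: "n \<le> bigOmega (card H) + eps" if "n \<in> ?S" for n
    using I_base_upper[OF fin H G odd] that eps by simp
  \<comment> \<open>The uniform bound also makes the set finite, without which \<open>Max\<close>
    would carry no information.\<close>
  then have finS: "finite ?S" by (meson finite_nat_set_iff_bounded_le)
  have ex: "\<exists>m\<in>?S. L - 1 + eps \<le> m"
  proof (cases "G = Sym V")
    case True
    \<comment> \<open>Subtraction is truncated: \<open>L = 0\<close> would turn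
      \<open>L - 1 + eps\<close> into 1, more than the length of the chain. It is excluded because
      the symmetric group contains the odd \<open>h\<close>.\<close>
    have "L \<noteq> 0"
    proof
      assume "L = 0"
      then have "Sym V = {id}" using st by simp
      then have "h = id" using odd perm_groupD(1)[OF H odd(1)] unfolding Sym_def by blast
      then show False using odd by simp
    qed
    then show ?thesis using st True eps by auto
  next
    case False
    then have GA: "G = Alt V" using G by blast
    have i: "{id} \<inter> Alt V = {id}" "Sym V \<inter> Alt V = Alt V" unfolding Alt_def Sym_def by (auto intro: permutes_id)
    from relpowp_base_step_Alt[OF fin H odd perm_group_Sym st] obtain m where
      "m \<ge> (if Sym V \<subseteq> Alt V then L else L - 1)" "(base_step V H (Alt V) ^^ m) (Alt V) {id}"
      unfolding i by blast
    then show ?thesis using False GA eps by (auto split: if_splits)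
  qed
  have "I_base G (H \<inter> G) \<in> ?S"
    unfolding I_base_eq_Max_relpowp[OF H pG] using finS ex by (intro Max_in) auto
  then show "I_base G (H \<inter> G) \<le> bigOmega (card H) + eps" using ub by blast
  show "L - 1 + eps \<le> I_base G (H \<inter> G)"
    unfolding I_base_eq_Max_relpowp[OF H pG] using finS ex Max_ge order_trans by blast
qed

section \<open>Centralisers of transpositions and signs of products of cycles\<close>

lemma transpose_commute_imp:
  assumes "bij f" "transpose a b \<circ> f = f \<circ> transpose a b" "a \<noteq> b"
  shows "f a = a \<or> f a = b"
proof (rule ccontr)
  assume "\<not> (f a = a \<or> f a = b)"
  then have "transpose a b (f a) = f a" by simp
  moreover have "transpose a b (f a) = f b" using fun_cong[OF assms(2), of a] by simp
  ultimately show False using assms(1,3) by (metis bij_is_inj injD)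
qed

lemma transpose_commute_fixes: "bij f \<Longrightarrow> f a = a \<Longrightarrow> f b = b \<Longrightarrow> transpose a b \<circ> f = f \<circ> transpose a b"
  by (metis bij_is_inj inv_f_eq transpose_comp_eq)

lemma transpose_commute_swaps: "bij f \<Longrightarrow> f a = b \<Longrightarrow> f b = a \<Longrightarrow> transpose a b \<circ> f = f \<circ> transpose a b"
  by (metis bij_is_inj inv_f_eq transpose_comp_eq transpose_commute)

lemma evenperm_cycle_of_list:
  assumes "cs \<noteq> []" "distinct cs"
  shows "evenperm (cycle_of_list cs) \<longleftrightarrow> odd (length cs)"
  using assms
proof (induction cs rule: cycle_of_list.induct)
  case (1 i j cs)
  then have IH: "evenperm (cycle_of_list (j # cs)) \<longleftrightarrow> odd (length (j # cs))" by simp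
  have "evenperm (cycle_of_list (i # j # cs)) \<longleftrightarrow>
      evenperm (transpose i j) = evenperm (cycle_of_list (j # cs))"
    unfolding cycle_of_list.simps(1) by (rule evenperm_comp[OF permutation_swap_id permutation_of_cycle])
  then show ?case unfolding IH using 1 by (simp add: evenperm_swap del: cycle_of_list.simps)
qed auto

lemma cycle_of_list_nth:
  assumes "distinct cs" "i < length cs"
  shows "cycle_of_list cs (cs ! i) = cs ! (Suc i mod length cs)"
proof -
  have "map (cycle_of_list cs) cs = rotate 1 cs" using cyclic_rotation[OF assms(1), of 1] by simp
  then have "map (cycle_of_list cs) cs ! i = rotate 1 cs ! i" by simp
  then show ?thesis using assms(2) by (simp add: nth_rotate del: rotate_Suc One_nat_def) simp
qed

text \<open>A cycle of even length is odd, so the sign of \<open>f\<close> is the parity of the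
  number of cycles. The induction splits off one cycle and replaces \<open>f\<close> by the identity
  on it; that \<open>f\<close> is a permutation comes out along the way.\<close>

lemma evenperm_product_of_even_cycles:
  assumes "finite R"
    and "\<And>r. r \<in> R \<Longrightarrow> distinct (cyc r) \<and> length (cyc r) = n" "even n" "n > 0"
    and "\<And>r s. r \<in> R \<Longrightarrow> s \<in> R \<Longrightarrow> r \<noteq> s \<Longrightarrow> set (cyc r) \<inter> set (cyc s) = {}"
    and "\<And>r i. r \<in> R \<Longrightarrow> i < n \<Longrightarrow> f (cyc r ! i) = cyc r ! (Suc i mod n)"
    and "\<And>x. (\<And>r. r \<in> R \<Longrightarrow> x \<notin> set (cyc r)) \<Longrightarrow> f x = x"
  shows "permutation f \<and> (evenperm f \<longleftrightarrow> even (card R))"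
  using assms
proof (induction R arbitrary: f rule: finite_induct)
  case empty
  then have "f = id" by auto
  then show ?case by simp
next
  case (insert r R)
  define c where "c = cycle_of_list (cyc r)"
  define f' where "f' x = (if x \<in> set (cyc r) then x else f x)" for x
  have r: "distinct (cyc r)" "length (cyc r) = n" using insert.prems(1) by auto
  have disj: "set (cyc r) \<inter> set (cyc s) = {}" if "s \<in> R" for s
    using insert.prems(4)[of r s] that insert.hyps by auto
  have "permutation f' \<and> (evenperm f' \<longleftrightarrow> even (card R))"
  proof (rule insert.IH)
    fix s i assume s: "s \<in> R" "i < n"
    have "length (cyc s) = n" using insert.prems(1) s by auto
    then have "cyc s ! i \<in> set (cyc s)" using s by simp
    then have "cyc s ! i \<notin> set (cyc r)" using disj s by blast
    then show "f' (cyc s ! i) = cyc s ! (Suc i mod n)"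
      unfolding f'_def using insert.prems(5) s by simp
  next
    fix x assume "\<And>s. s \<in> R \<Longrightarrow> x \<notin> set (cyc s)"
    then show "f' x = x" unfolding f'_def using insert.prems(6) by (metis insertE)
  qed (use insert.prems in auto)
  moreover have fc: "f = c \<circ> f'"
  proof
    fix x show "f x = (c \<circ> f') x"
    proof (cases "x \<in> set (cyc r)")
      case True
      then obtain i where i: "i < n" "x = cyc r ! i" using r by (metis in_set_conv_nth)
      have "c x = cyc r ! (Suc i mod n)" unfolding c_def i(2) using cycle_of_list_nth[OF r(1)] i r by simp
      then show ?thesis using True insert.prems(5)[of r i] i unfolding f'_def by simp
    next
      case False
      have "f x \<notin> set (cyc r)"
      proof (cases "\<exists>s\<in>R. x \<in> set (cyc s)")
        case True
        then obtain s where s: "s \<in> R" "x \<in> set (cyc s)" by blast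
        have l: "length (cyc s) = n" using insert.prems(1) s by auto
        then obtain i where i: "i < n" "x = cyc s ! i" using s by (metis in_set_conv_nth)
        have "f x \<in> set (cyc s)" unfolding i(2) using insert.prems(5)[of s i] s i l insert.prems(3) by simp
        then show ?thesis using disj s by blast
      next
        case nex: False
        then have "f x = x" using insert.prems(6)[of x] False by blast
        then show ?thesis using False by simp
      qed
      then have "c (f x) = f x" unfolding c_def using id_outside_supp by metis
      then show ?thesis using False unfolding f'_def by simp
    qed
  qed
  moreover have "\<not> evenperm c" unfolding c_def
    using evenperm_cycle_of_list[of "cyc r"] r insert.prems(2,3) by auto
  moreover have "permutation c" unfolding c_def by (rule permutation_of_cycle)
  ultimately have "permutation (c \<circ> f')" "evenperm (c \<circ> f') \<longleftrightarrow> odd (card R)"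
    using evenperm_comp[of c f'] permutation_compose[of c f'] by auto
  moreover have "even (card (insert r R)) \<longleftrightarrow> odd (card R)" using insert.hyps by simp
  ultimately show ?case by (simp only: fc)
qed

section \<open>Affine maps over a prime field\<close>

definition zero_vec :: "nat \<Rightarrow> nat" where
  "zero_vec = (\<lambda>_. 0)"

definition unit_vec :: "nat \<Rightarrow> nat \<Rightarrow> nat" where
  "unit_vec i = (\<lambda>j. if j = i then 1 else 0)"

locale odd_prime_space =
  fixes p d :: nat
  assumes prime_p: "prime p" and odd_p: "odd p" and d_pos: "d > 0"
begin

abbreviation V :: "(nat \<Rightarrow> nat) set" where "V \<equiv> Vec p d"

lemma p_gt_2: "p > 2"
  using prime_p odd_p prime_ge_2_nat[of p] by (cases "p = 2") auto

lemma p_pos [simp]: "p > 0"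
  using p_gt_2 by simp

lemma Vec_less: "x \<in> V \<Longrightarrow> x i < p"
  unfolding Vec_def using p_pos by (cases "i < d") auto

lemma Vec_0: "x \<in> V \<Longrightarrow> i \<ge> d \<Longrightarrow> x i = 0"
  unfolding Vec_def by auto

lemma VecI: "(\<And>i. x i < p) \<Longrightarrow> (\<And>i. i \<ge> d \<Longrightarrow> x i = 0) \<Longrightarrow> x \<in> V"
  unfolding Vec_def by auto

lemma zero_vec_in [simp]: "zero_vec \<in> V"
  unfolding zero_vec_def by (intro VecI) auto

lemma unit_vec_in: "i < d \<Longrightarrow> unit_vec i \<in> V"
  unfolding unit_vec_def using p_gt_2 by (intro VecI) auto

text \<open>Coordinates are natural numbers, while affine identities need subtraction. Such
  identities are therefore proved as congruences of integers modulo \<open>p\<close> and turned back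
  into equality of vectors here.\<close>

lemma Vec_eqI:
  assumes "x \<in> V" "y \<in> V" "\<And>i. i < d \<Longrightarrow> [int (x i) = int (y i)] (mod int p)"
  shows "x = y"
proof
  fix i show "x i = y i"
  proof (cases "i < d")
    case True
    then have "[x i = y i] (mod p)" using assms(3) cong_int_iff by blast
    then show ?thesis using Vec_less[OF assms(1)] Vec_less[OF assms(2)] by (simp add: cong_less_modulus_unique_nat)
  qed (use Vec_0[OF assms(1)] Vec_0[OF assms(2)] in auto)
qed

text \<open>The affine combination x + k (z - y); affine maps over a prime field are the maps that
  preserve it.\<close>
definition shift :: "(nat \<Rightarrow> nat) \<Rightarrow> nat \<Rightarrow> (nat \<Rightarrow> nat) \<Rightarrow> (nat \<Rightarrow> nat) \<Rightarrow> nat \<Rightarrow> nat" where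
  "shift x k y z = (\<lambda>i. (x i + k * (z i + (p - y i))) mod p)"

lemma shift_in: "x \<in> V \<Longrightarrow> y \<in> V \<Longrightarrow> z \<in> V \<Longrightarrow> shift x k y z \<in> V"
  unfolding shift_def by (intro VecI) (auto simp: Vec_0)

lemma shift_cong:
  assumes "y \<in> V"
  shows "[int (shift x k y z i) = int (x i) + int k * (int (z i) - int (y i))] (mod int p)"
proof -
  have e: "int (p - y i) = int p - int (y i)" using Vec_less[OF assms, of i] by simp
  have "int (x i + k * (z i + (p - y i))) = int (x i) + int k * (int (z i) - int (y i)) + int p * int k"
    unfolding of_nat_add of_nat_mult e by (simp add: algebra_simps)
  then show ?thesis unfolding shift_def cong_def zmod_int
    by (simp only: mod_mod_trivial mod_mult_self2)
qed

section \<open>Affine maps as maps preserving affine combinations\<close>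

lemma AGL_matrix:
  assumes "f \<in> AGL d p"
  obtains A b where "\<And>x i. x \<in> V \<Longrightarrow> i < d \<Longrightarrow>
    [int (f x i) = (\<Sum>j<d. A i j * int (x j)) + b i] (mod int p)"
proof -
  obtain A b where Ab: "\<And>x. x \<in> V \<Longrightarrow>
      f x = (\<lambda>i. if i < d then ((\<Sum>j<d. A i j * x j) + b i) mod p else 0)"
    using assms unfolding AGL_def by blast
  have "[int (f x i) = (\<Sum>j<d. int (A i j) * int (x j)) + int (b i)] (mod int p)"
    if "x \<in> V" "i < d" for x i
    using that by (simp add: Ab zmod_int cong_def)
  then show thesis using that[of "\<lambda>i j. int (A i j)" "\<lambda>i. int (b i)"] by blast
qed

lemma AGL_permutes: "f \<in> AGL d p \<Longrightarrow> f permutes V"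
  unfolding AGL_def by blast

lemma permutes_in: "f permutes V \<Longrightarrow> x \<in> V \<Longrightarrow> f x \<in> V"
  by (simp add: permutes_in_image)

lemma AGL_in: "f \<in> AGL d p \<Longrightarrow> x \<in> V \<Longrightarrow> f x \<in> V"
  using AGL_permutes permutes_in by blast

lemma AGL_shift:
  assumes f: "f \<in> AGL d p" and v: "x \<in> V" "y \<in> V" "z \<in> V"
  shows "f (shift x k y z) = shift (f x) k (f y) (f z)"
proof (rule Vec_eqI)
  show "f (shift x k y z) \<in> V" "shift (f x) k (f y) (f z) \<in> V"
    using v by (simp_all add: shift_in AGL_in f)
  fix i assume i: "i < d"
  obtain A b where Ab: "\<And>x i. x \<in> V \<Longrightarrow> i < d \<Longrightarrow>
    [int (f x i) = (\<Sum>j<d. A i j * int (x j)) + b i] (mod int p)"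
    using AGL_matrix[OF f] by blast
  let ?L = "\<lambda>x. (\<Sum>j<d. A i j * int (x j)) + b i"
  have "[int (f (shift x k y z) i) = ?L (shift x k y z)] (mod int p)"
    using Ab shift_in v i by blast
  also have "[?L (shift x k y z) =
      (\<Sum>j<d. A i j * (int (x j) + int k * (int (z j) - int (y j)))) + b i] (mod int p)"
    by (intro cong_add cong_sum cong_mult cong_refl shift_cong v)
  also have "(\<Sum>j<d. A i j * (int (x j) + int k * (int (z j) - int (y j)))) + b i
      = ?L x + int k * (?L z - ?L y)"
    by (simp add: algebra_simps sum.distrib sum_subtractf sum_distrib_left)
  also have "[?L x + int k * (?L z - ?L y) = int (f x i) + int k * (int (f z i) - int (f y i))] (mod int p)"
    by (intro cong_add cong_mult cong_diff cong_refl cong_sym[OF Ab] v i)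
  also have "[int (f x i) + int k * (int (f z i) - int (f y i)) = int (shift (f x) k (f y) (f z) i)] (mod int p)"
    by (rule cong_sym, rule shift_cong) (simp add: AGL_in f v)
  finally show "[int (f (shift x k y z) i) = int (shift (f x) k (f y) (f z) i)] (mod int p)" .
qed

text \<open>Over a prime field every scalar is a repeated sum of 1, so the combinations with
  \<open>k = 1\<close> already characterise affine maps. Column \<open>j\<close> of the matrix is
  the value at a unit vector minus the value at 0, and induction on the sum of the coordinates of
  \<open>x\<close> takes away one unit vector at a time.\<close>

lemma AGL_I:
  assumes f: "f permutes V"
    and sh: "\<And>x y z. x \<in> V \<Longrightarrow> y \<in> V \<Longrightarrow> z \<in> V \<Longrightarrow> f (shift x 1 y z) = shift (f x) 1 (f y) (f z)"
  shows "f \<in> AGL d p"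
proof -
  define b where "b = f zero_vec"
  define A where "A i j = f (unit_vec j) i + (p - b i)" for i j
  have bV: "b \<in> V" unfolding b_def using permutes_in[OF f] by simp
  have main: "[int (f x i) = int ((\<Sum>j<d. A i j * x j) + b i)] (mod int p)" if "x \<in> V" "i < d" for x i
    using that(1)
  proof (induction "\<Sum>j<d. x j" arbitrary: x)
    case 0
    then have "\<forall>j<d. x j = 0" by simp
    then have "x = zero_vec" unfolding zero_vec_def using Vec_0[OF 0(2)] by (metis linorder_not_le)
    then show ?case by (simp add: b_def zero_vec_def)
  next
    case (Suc n)
    then obtain j where j: "j < d" "x j > 0" by (metis (no_types, lifting) gr0I lessThan_iff sum.neutral nat.distinct(1))
    define y where "y = x(j := x j - 1)"
    have yV: "y \<in> V" unfolding y_def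
    proof (rule VecI)
      fix i show "(x(j := x j - 1)) i < p" using Vec_less[OF Suc.prems, of i] by (cases "i = j") auto
    qed (use Vec_0[OF Suc.prems] j in auto)
    have sumy: "(\<Sum>l<d. B l * x l) = (\<Sum>l<d. B l * y l) + B j" for B :: "nat \<Rightarrow> nat"
    proof -
      have "(\<Sum>l<d. B l * x l) = B j * x j + (\<Sum>l\<in>{..<d}-{j}. B l * x l)"
        using j by (simp add: sum.remove)
      also have "(\<Sum>l\<in>{..<d}-{j}. B l * x l) = (\<Sum>l\<in>{..<d}-{j}. B l * y l)"
        unfolding y_def by (intro sum.cong) auto
      also have "B j * x j = B j * y j + B j" using j unfolding y_def
        by (cases "x j") auto
      finally show ?thesis using j by (simp add: sum.remove)
    qed
    have "n = (\<Sum>l<d. y l)" using sumy[of "\<lambda>_. 1"] Suc(2) by simp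
    then have IH: "[int (f y i) = int ((\<Sum>l<d. A i l * y l) + b i)] (mod int p)"
      using Suc(1) yV by blast
    have "x = shift y 1 zero_vec (unit_vec j)"
    proof
      fix l show "x l = shift y 1 zero_vec (unit_vec j) l"
        using j Vec_less[OF Suc.prems, of l] unfolding shift_def y_def zero_vec_def unit_vec_def by auto
    qed
    then have "f x = shift (f y) 1 b (f (unit_vec j))"
      unfolding b_def using sh[OF yV zero_vec_in unit_vec_in[OF j(1)]] by simp
    then have "[int (f x i) = int (f y i) + int 1 * (int (f (unit_vec j) i) - int (b i))] (mod int p)"
      using shift_cong[OF bV, of "f y" 1 "f (unit_vec j)" i] by simp
    also have "[int (f y i) + int 1 * (int (f (unit_vec j) i) - int (b i)) =
      int ((\<Sum>l<d. A i l * y l) + b i) + int (A i j)] (mod int p)"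
    proof (rule cong_add[OF IH])
      have "int (A i j) = int (f (unit_vec j) i) - int (b i) + int p"
        unfolding A_def using Vec_less[OF bV, of i] by simp
      then show "[int 1 * (int (f (unit_vec j) i) - int (b i)) = int (A i j)] (mod int p)"
        by (simp add: cong_def)
    qed
    finally show ?case using sumy[of "A i"] by (simp add: add_ac)
  qed
  have "f x = (\<lambda>i. if i < d then ((\<Sum>j<d. A i j * x j) + b i) mod p else 0)" if "x \<in> V" for x
  proof
    fix i
    have "[f x i = (\<Sum>j<d. A i j * x j) + b i] (mod p)" if "i < d"
      using main[OF \<open>x \<in> V\<close> that] cong_int_iff by blast
    then show "f x i = (if i < d then ((\<Sum>j<d. A i j * x j) + b i) mod p else 0)"
      using Vec_less[OF permutes_in[OF f \<open>x \<in> V\<close>], of i] Vec_0[OF permutes_in[OF f \<open>x \<in> V\<close>]]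
      by (auto simp: cong_def)
  qed
  then show ?thesis unfolding AGL_def using f by blast
qed

lemma finite_V: "finite V"
proof -
  have "V \<subseteq> {f. \<forall>x. (x \<in> {..<d} \<longrightarrow> f x \<in> {..<p}) \<and> (x \<notin> {..<d} \<longrightarrow> f x = 0)}"
    unfolding Vec_def by auto
  then show ?thesis using finite_set_of_finite_funs[of "{..<d}" "{..<p}" 0] finite_subset by blast
qed

text \<open>Preservation of \<open>shift\<close> passes directly to composites and inverses, so no
  matrix has to be multiplied or inverted.\<close>

lemma AGL_group: "perm_group V (AGL d p)"
  unfolding perm_group_def
proof (intro conjI ballI subsetI)
  show "f \<in> Sym V" if "f \<in> AGL d p" for f using that AGL_permutes unfolding Sym_def by blast
  show "id \<in> AGL d p" by (rule AGL_I) (auto intro: permutes_id)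
  show "f \<circ> g \<in> AGL d p" if "f \<in> AGL d p" "g \<in> AGL d p" for f g
    using that by (intro AGL_I) (auto simp: AGL_shift AGL_in AGL_permutes permutes_compose)
  fix f assume f: "f \<in> AGL d p"
  note fp = AGL_permutes[OF f]
  show "inv f \<in> AGL d p"
  proof (rule AGL_I)
    show ip: "inv f permutes V" using fp permutes_inv by blast
    fix x y z assume v: "x \<in> V" "y \<in> V" "z \<in> V"
    have "f (shift (inv f x) 1 (inv f y) (inv f z)) = shift x 1 y z"
      using AGL_shift[OF f] permutes_in[OF ip] v permutes_inverses[OF fp] by simp
    then show "inv f (shift x 1 y z) = shift (inv f x) 1 (inv f y) (inv f z)"
      using permutes_inv_eq[OF fp] by blast
  qed
qed

lemmas AGL_comp = perm_groupD(3)[OF AGL_group]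
  and AGL_inv = perm_groupD(4)[OF AGL_group]

section \<open>Coordinate subspaces and the points moved by an affine map\<close>

definition coord_subspace :: "nat set \<Rightarrow> (nat \<Rightarrow> nat) set" where
  "coord_subspace S = {x\<in>V. \<forall>i. i \<notin> S \<longrightarrow> x i = 0}"

lemma card_coord_subspace:
  assumes "S \<subseteq> {..<d}"
  shows "card (coord_subspace S) = p ^ card S"
proof -
  have fin: "finite S" using assms finite_subset by blast
  have "bij_betw (\<lambda>x. restrict x S) (coord_subspace S) (S \<rightarrow>\<^sub>E {..<p})"
  proof (rule bij_betw_byWitness[where f'="\<lambda>x i. if i \<in> S then x i else 0"])
    show "(\<lambda>x. restrict x S) ` coord_subspace S \<subseteq> S \<rightarrow>\<^sub>E {..<p}"
      unfolding coord_subspace_def using Vec_less by auto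
    show "(\<lambda>x i. if i \<in> S then x i else 0) ` (S \<rightarrow>\<^sub>E {..<p}) \<subseteq> coord_subspace S"
      unfolding coord_subspace_def using assms by (auto intro!: VecI simp: PiE_iff)
  qed (auto simp: coord_subspace_def fun_eq_iff PiE_iff extensional_def)
  then have "card (coord_subspace S) = card (S \<rightarrow>\<^sub>E {..<p})" by (rule bij_betw_same_card)
  then show ?thesis using fin by (simp add: card_PiE)
qed

lemma coord_subspace_full: "coord_subspace {..<d} = V"
  unfolding coord_subspace_def using Vec_0 by auto

lemma card_V: "card V = p ^ d"
  using card_coord_subspace[of "{..<d}"] coord_subspace_full by simp

text \<open>If f fixes u but not v, then the p translates of the fixed set by multiples of v - u are
  disjoint.\<close>
lemma AGL_fixed_points:
  assumes f: "f \<in> AGL d p" "f \<noteq> id"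
  shows "p * card {x\<in>V. f x = x} \<le> p ^ d"
proof (cases "{x\<in>V. f x = x} = {}")
  case False
  define F where "F = {x\<in>V. f x = x}"
  obtain u where u: "u \<in> V" "f u = u" using False by blast
  obtain v where v: "f v \<noteq> v" using f(2) by fastforce
  have vV: "v \<in> V" using v AGL_permutes[OF f(1)] permutes_not_in by metis
  have fvV: "f v \<in> V" using AGL_in f vV by blast
  obtain i where i: "i < d" "\<not> [int (f v i) = int (v i)] (mod int p)"
    using Vec_eqI[OF fvV vV] v by blast
  have inj: "inj_on (\<lambda>(k, x). shift x k u v) ({..<p} \<times> F)"
  proof (rule inj_onI)
    fix a b assume ab: "a \<in> {..<p} \<times> F" "b \<in> {..<p} \<times> F"
      "(\<lambda>(k, x). shift x k u v) a = (\<lambda>(k, x). shift x k u v) b"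
    obtain k x where a: "a = (k, x)" by (cases a)
    obtain l y where b: "b = (l, y)" by (cases b)
    have kx: "k < p" "x \<in> V" "f x = x" "l < p" "y \<in> V" "f y = y"
      using ab unfolding F_def a b by auto
    have e: "shift x k u v = shift y l u v" using ab a b by simp
    \<comment> \<open>Here \<open>f\<close> is applied to both sides; it fixes \<open>x\<close>,
      \<open>y\<close> and \<open>u\<close>. The difference from the original equation is
      \<open>k - l\<close> times \<open>f v - v\<close>, and coordinate \<open>i\<close> of the
      latter is invertible modulo \<open>p\<close>.\<close>
    have e': "shift x k u (f v) = shift y l u (f v)"
      using arg_cong[OF e, of f] AGL_shift[OF f(1)] kx u vV by simp
    have c: "[int (x j) + int k * (int (w j) - int (u j)) = int (y j) + int l * (int (w j) - int (u j))] (mod int p)"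
      if "shift x k u w = shift y l u w" for w j
      using shift_cong[OF u(1), of x k w j] shift_cong[OF u(1), of y l w j] that
      by (metis cong_sym cong_trans)
    have "[(int k - int l) * (int (f v i) - int (v i)) = 0] (mod int p)"
      using cong_diff[OF c[OF e', of i] c[OF e, of i]] by (simp add: algebra_simps cong_iff_dvd_diff)
    then have "int p dvd (int k - int l) * (int (f v i) - int (v i))" by (simp add: cong_0_iff)
    then have "int p dvd int k - int l"
      using i(2) prime_p by (simp add: prime_dvd_mult_iff cong_iff_dvd_diff)
    then have "[k = l] (mod p)" by (metis cong_iff_dvd_diff cong_int_iff)
    then have kl: "k = l" using kx by (simp add: cong_less_modulus_unique_nat)
    have "x = y" using c[OF e] kl by (intro Vec_eqI kx) (simp add: cong_iff_dvd_diff)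
    then show "a = b" using kl a b by simp
  qed
  have "card ({..<p} \<times> F) \<le> card V"
    by (rule card_inj_on_le[OF inj]) (use vV u in \<open>auto simp: F_def shift_in finite_V\<close>)
  then show ?thesis using card_V by (simp add: F_def card_cartesian_product)
next
  case True
  show ?thesis unfolding True by simp
qed

lemma AGL_moved_points:
  assumes f: "f \<in> AGL d p" "f \<noteq> id"
  shows "card {x. f x \<noteq> x} \<ge> p ^ d - p ^ (d - 1)"
proof -
  have "p * card {x\<in>V. f x = x} \<le> p * p ^ (d - 1)"
    using AGL_fixed_points[OF f] d_pos by (simp add: power_eq_if)
  then have le: "card {x\<in>V. f x = x} \<le> p ^ (d - 1)" by simp
  have "{x. f x \<noteq> x} = V - {x\<in>V. f x = x}"
    using permutes_not_in[OF AGL_permutes[OF f(1)]] by blast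
  then have "card {x. f x \<noteq> x} = p ^ d - card {x\<in>V. f x = x}"
    using finite_V card_V by (simp add: card_Diff_subset)
  then show ?thesis using le by simp
qed

definition small :: "((nat \<Rightarrow> nat) \<Rightarrow> nat \<Rightarrow> nat) \<Rightarrow> bool" where
  "small g \<longleftrightarrow> g permutes V \<and> 2 * card {x. g x \<noteq> x} < p ^ d - p ^ (d - 1)"

lemma conj_stab_small_iff:
  assumes g: "small g" and f: "f \<in> AGL d p"
  shows "f \<in> conj_stab V (AGL d p) g \<longleftrightarrow> g \<circ> f = f \<circ> g"
proof
  note fp = AGL_permutes[OF f]
  have gp: "g permutes V" using g small_def by blast
  {
    assume c: "g \<circ> f = f \<circ> g"
    have "g \<circ> f \<circ> inv g = f" unfolding c using perm_comp_cancel(3)[OF gp] by simp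
    then show "f \<in> conj_stab V (AGL d p) g" unfolding conj_stab_def Sym_def using fp f by simp
  next
    assume "f \<in> conj_stab V (AGL d p) g"
    then have "g \<circ> f \<circ> inv g \<in> AGL d p" unfolding conj_stab_def by blast
    then have h: "(g \<circ> f \<circ> inv g) \<circ> inv f \<in> AGL d p" (is "?h \<in> _") using AGL_comp AGL_inv f by blast
    let ?M = "{x. g x \<noteq> x}"
    have finM: "finite ?M"
      by (rule finite_subset[OF _ finite_V]) (use permutes_not_in[OF gp] in blast)
    \<comment> \<open>The commutator is the product of \<open>g\<close> and the conjugate of
      \<open>inv g\<close> by \<open>f\<close>, whose support is the image of \<open>?M\<close>
      under \<open>f\<close>.\<close>
    have "{x. ?h x \<noteq> x} \<subseteq> ?M \<union> f ` ?M"
    proof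
      fix x assume x: "x \<in> {x. ?h x \<noteq> x}"
      show "x \<in> ?M \<union> f ` ?M"
      proof (rule ccontr)
        assume n: "x \<notin> ?M \<union> f ` ?M"
        have "x = f (inv f x)" using permutes_inverses[OF fp] by simp
        then have "g (inv f x) = inv f x" using n by blast
        then have "inv g (inv f x) = inv f x" using permutes_inv_eq[OF gp] by simp
        then have "?h x = x" using n permutes_inverses[OF fp] by simp
        then show False using x by blast
      qed
    qed
    then have "card {x. ?h x \<noteq> x} \<le> card (?M \<union> f ` ?M)" using finM by (intro card_mono) auto
    also have "\<dots> \<le> card ?M + card (f ` ?M)" by (rule card_Un_le)
    also have "\<dots> \<le> 2 * card ?M" using card_image_le[OF finM, of f] by simp
    also have "\<dots> < p ^ d - p ^ (d - 1)" using g small_def by blast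
    finally have "?h = id" using AGL_moved_points[OF h] by linarith
    then have "?h \<circ> (f \<circ> g) = f \<circ> g" by simp
    moreover have "?h \<circ> (f \<circ> g) = g \<circ> f"
      by (rule ext) (simp add: permutes_inverses[OF fp] permutes_inverses[OF gp])
    ultimately show "g \<circ> f = f \<circ> g" by simp
  }
qed

section \<open>Explicit affine maps: changed columns and translations\<close>

lemma cong_mult_cancel:
  assumes "[int a * int c = int b * int c] (mod int p)" "c < p" "c \<noteq> 0"
  shows "[int a = int b] (mod int p)"
proof -
  have "coprime (int c) (int p)"
    using assms(2,3) prime_p by (metis coprime_commute coprime_int_iff nat_dvd_not_less neq0_conv prime_imp_coprime_nat)
  then show ?thesis using assms(1) cong_mult_rcancel by blast
qed

text \<open>On \<open>V\<close>, the linear map whose matrix is the identity with column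
  \<open>k\<close> replaced by \<open>v\<close>. Outside \<open>V\<close> it is the identity, as
  \<open>Sym V\<close> demands of functions on the whole type.\<close>

definition colmap :: "nat \<Rightarrow> (nat \<Rightarrow> nat) \<Rightarrow> (nat \<Rightarrow> nat) \<Rightarrow> nat \<Rightarrow> nat" where
  "colmap k v x = (if x \<in> V then (\<lambda>i. ((if i = k then 0 else x i) + x k * v i) mod p) else x)"

lemma colmap_in: "v \<in> V \<Longrightarrow> x \<in> V \<Longrightarrow> k < d \<Longrightarrow> colmap k v x \<in> V"
  unfolding colmap_def by (auto intro!: VecI simp: Vec_0)

lemma colmap_cong:
  "x \<in> V \<Longrightarrow> [int (colmap k v x i) = (if i = k then 0 else int (x i)) + int (x k) * int (v i)] (mod int p)"
  unfolding colmap_def cong_def by (auto simp: zmod_int)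

lemma colmap_fix: "x k = 0 \<Longrightarrow> colmap k v x = x"
  unfolding colmap_def using Vec_less by (auto simp: fun_eq_iff)

lemma colmap_unit_vec: "k < d \<Longrightarrow> v \<in> V \<Longrightarrow> colmap k v (unit_vec k) = v"
  unfolding colmap_def using Vec_less[of v] unit_vec_in[of k] by (auto simp: fun_eq_iff unit_vec_def)

lemma colmap_AGL:
  assumes k: "k < d" and v: "v \<in> V" "v k \<noteq> 0"
  shows "colmap k v \<in> AGL d p"
proof (rule AGL_I)
  show "colmap k v permutes V"
  proof (rule inj_imp_permutes)
    show "inj_on (colmap k v) V"
    proof (rule inj_onI)
      fix x y assume xy: "x \<in> V" "y \<in> V" "colmap k v x = colmap k v y"
      have c: "[(if i = k then 0 else int (x i)) + int (x k) * int (v i) =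
          (if i = k then 0 else int (y i)) + int (y k) * int (v i)] (mod int p)" for i
        using colmap_cong[OF xy(1), of k v i] colmap_cong[OF xy(2), of k v i] xy(3)
        by (metis cong_sym cong_trans)
      have "[int (x k) = int (y k)] (mod int p)"
        using c[of k] v Vec_less[OF v(1), of k] cong_mult_cancel[of "x k" "v k" "y k"] by simp
      then have "x k = y k" using Vec_less[OF xy(1), of k] Vec_less[OF xy(2), of k]
        by (simp add: cong_int_iff cong_less_modulus_unique_nat)
      then have "[int (x i) = int (y i)] (mod int p)" for i
        using c[of i] by (cases "i = k") (auto simp: cong_add_rcancel)
      then show "x = y" using Vec_eqI xy by blast
    qed
  qed (use finite_V colmap_in[OF v(1) _ k] in \<open>auto simp: colmap_def\<close>)
  fix x y z assume xyz: "x \<in> V" "y \<in> V" "z \<in> V"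
  show "colmap k v (shift x 1 y z) = shift (colmap k v x) 1 (colmap k v y) (colmap k v z)"
  proof (rule Vec_eqI)
    fix i
    let ?L = "\<lambda>x. (if i = k then 0 else int (x i)) + int (x k) * int (v i)"
    let ?s = "\<lambda>j. int (x j) + int 1 * (int (z j) - int (y j))"
    have "[int (colmap k v (shift x 1 y z) i) = ?L (shift x 1 y z)] (mod int p)"
      using colmap_cong shift_in xyz by blast
    also have "[?L (shift x 1 y z) = (if i = k then 0 else ?s i) + ?s k * int (v i)] (mod int p)"
      by (intro cong_add cong_mult cong_refl shift_cong xyz) (use shift_cong[OF xyz(2), of x 1 z i] in auto)
    also have "(if i = k then 0 else ?s i) + ?s k * int (v i) = ?L x + int 1 * (?L z - ?L y)"
      by (simp add: algebra_simps)
    also have "[?L x + int 1 * (?L z - ?L y) =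
        int (colmap k v x i) + int 1 * (int (colmap k v z i) - int (colmap k v y i))] (mod int p)"
      by (intro cong_add cong_mult cong_diff cong_refl cong_sym[OF colmap_cong] xyz)
    also have "[int (colmap k v x i) + int 1 * (int (colmap k v z i) - int (colmap k v y i)) =
        int (shift (colmap k v x) 1 (colmap k v y) (colmap k v z) i)] (mod int p)"
      by (rule cong_sym, rule shift_cong) (simp add: colmap_in v xyz k)
    finally show "[int (colmap k v (shift x 1 y z) i) =
        int (shift (colmap k v x) 1 (colmap k v y) (colmap k v z) i)] (mod int p)" .
  qed (use xyz v k in \<open>simp_all add: colmap_in shift_in\<close>)
qed

definition transl :: "(nat \<Rightarrow> nat) \<Rightarrow> (nat \<Rightarrow> nat) \<Rightarrow> nat \<Rightarrow> nat" where
  "transl v x = (if x \<in> V then shift x 1 zero_vec v else x)"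

lemma transl_cong: "x \<in> V \<Longrightarrow> [int (transl v x i) = int (x i) + int (v i)] (mod int p)"
  using shift_cong[OF zero_vec_in, of x 1 v i] by (simp add: transl_def zero_vec_def)

lemma transl_in: "v \<in> V \<Longrightarrow> x \<in> V \<Longrightarrow> transl v x \<in> V"
  unfolding transl_def by (simp add: shift_in)

lemma transl_zero: "v \<in> V \<Longrightarrow> transl v zero_vec = v"
  by (rule Vec_eqI) (use transl_cong[OF zero_vec_in, of v] in \<open>simp_all add: transl_in, simp add: zero_vec_def\<close>)

lemma transl_AGL:
  assumes v: "v \<in> V"
  shows "transl v \<in> AGL d p"
proof (rule AGL_I)
  show "transl v permutes V"
  proof (rule inj_imp_permutes)
    show "inj_on (transl v) V"
    proof (rule inj_onI)
      fix x y assume xy: "x \<in> V" "y \<in> V" "transl v x = transl v y"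
      have "[int (x i) = int (y i)] (mod int p)" for i
        using cong_trans[OF cong_sym[OF transl_cong[OF xy(1), of v i]] transl_cong[OF xy(2), of v i, folded xy(3)]]
        by (simp add: cong_add_rcancel)
      then show "x = y" using Vec_eqI xy by blast
    qed
  qed (use finite_V transl_in[OF v] in \<open>auto simp: transl_def\<close>)
  fix x y z assume xyz: "x \<in> V" "y \<in> V" "z \<in> V"
  show "transl v (shift x 1 y z) = shift (transl v x) 1 (transl v y) (transl v z)"
  proof (rule Vec_eqI)
    fix i
    have "[int (transl v (shift x 1 y z) i) = int (shift x 1 y z i) + int (v i)] (mod int p)"
      using transl_cong shift_in xyz by blast
    also have "[int (shift x 1 y z i) + int (v i) =
        int (x i) + int 1 * (int (z i) - int (y i)) + int (v i)] (mod int p)"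
      by (intro cong_add cong_refl shift_cong xyz)
    also have "int (x i) + int 1 * (int (z i) - int (y i)) + int (v i) =
        (int (x i) + int (v i)) + int 1 * ((int (z i) + int (v i)) - (int (y i) + int (v i)))" by simp
    also have "[(int (x i) + int (v i)) + int 1 * ((int (z i) + int (v i)) - (int (y i) + int (v i))) =
        int (transl v x i) + int 1 * (int (transl v z i) - int (transl v y i))] (mod int p)"
      by (intro cong_add cong_mult cong_diff cong_refl cong_sym[OF transl_cong] xyz)
    also have "[int (transl v x i) + int 1 * (int (transl v z i) - int (transl v y i)) =
        int (shift (transl v x) 1 (transl v y) (transl v z) i)] (mod int p)"
      by (rule cong_sym, rule shift_cong) (simp add: transl_in v xyz)
    finally show "[int (transl v (shift x 1 y z) i) =
        int (shift (transl v x) 1 (transl v y) (transl v z) i)] (mod int p)" .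
  qed (use xyz v in \<open>simp_all add: transl_in shift_in\<close>)
qed

section \<open>The order of the affine group\<close>

lemma AGL_linear:
  assumes f: "f \<in> AGL d p" "f zero_vec = zero_vec" and x: "x \<in> V" "i < d"
  shows "[int (f x i) = (\<Sum>j<d. int (f (unit_vec j) i) * int (x j))] (mod int p)"
proof -
  obtain A b where Ab: "\<And>x i. x \<in> V \<Longrightarrow> i < d \<Longrightarrow>
    [int (f x i) = (\<Sum>j<d. A i j * int (x j)) + b i] (mod int p)"
    using AGL_matrix[OF f(1)] by blast
  have b: "[b i = 0] (mod int p)"
    using Ab[OF zero_vec_in x(2)] f(2) by (simp add: zero_vec_def cong_sym)
  have A: "[A i j = int (f (unit_vec j) i)] (mod int p)" if "j < d" for j
  proof -
    have "(\<Sum>l<d. A i l * int (unit_vec j l)) = A i j"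
      using that unfolding unit_vec_def by (simp add: if_distrib[of int] if_distrib[of "(*) _"] sum.delta cong: if_cong)
    then have "[int (f (unit_vec j) i) = A i j + b i] (mod int p)"
      using Ab[OF unit_vec_in[OF that] x(2)] by simp
    also have "[A i j + b i = A i j + 0] (mod int p)" by (intro cong_add cong_refl b)
    finally show ?thesis by (simp add: cong_sym)
  qed
  have "[int (f x i) = (\<Sum>j<d. A i j * int (x j)) + b i] (mod int p)" using Ab x by blast
  also have "[(\<Sum>j<d. A i j * int (x j)) + b i = (\<Sum>j<d. int (f (unit_vec j) i) * int (x j)) + 0] (mod int p)"
    by (intro cong_add cong_sum cong_mult cong_refl b A) auto
  finally show ?thesis by simp
qed

text \<open>The orbits along 0 and the successive unit vectors supply the factors of the order of
  the affine group. At \<open>k = 0\<close> this is the general linear group.\<close>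

definition frame_stab :: "nat \<Rightarrow> ((nat \<Rightarrow> nat) \<Rightarrow> nat \<Rightarrow> nat) set" where
  "frame_stab k = {f \<in> AGL d p. f zero_vec = zero_vec \<and> (\<forall>l<k. f (unit_vec l) = unit_vec l)}"

lemma frame_stab_group: "perm_group V (frame_stab k)"
proof -
  have "frame_stab k = {f \<in> AGL d p. \<forall>x \<in> insert zero_vec (unit_vec ` {..<k}). f x = x}"
    unfolding frame_stab_def by auto
  then show ?thesis using perm_group_fixing[OF AGL_group] by (simp only:)
qed

lemma frame_stab_fixes:
  assumes f: "f \<in> frame_stab k" and k: "k \<le> d" and x: "x \<in> coord_subspace {..<k}"
  shows "f x = x"
proof (rule Vec_eqI)
  have f': "f \<in> AGL d p" "f zero_vec = zero_vec" using f unfolding frame_stab_def by auto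
  show xV: "x \<in> V" using x unfolding coord_subspace_def by blast
  then show "f x \<in> V" using AGL_in f' by blast
  fix i assume i: "i < d"
  have "(\<Sum>j<d. int (f (unit_vec j) i) * int (x j)) = (\<Sum>j<d. if j = i then int (x j) else 0)"
  proof (rule sum.cong[OF refl])
    fix j
    show "int (f (unit_vec j) i) * int (x j) = (if j = i then int (x j) else 0)"
    proof (cases "j < k")
      case True
      then have "f (unit_vec j) = unit_vec j" using f unfolding frame_stab_def by blast
      then show ?thesis by (simp add: unit_vec_def)
    next
      case False
      then have "x j = 0" using x unfolding coord_subspace_def by simp
      then show ?thesis by auto
    qed
  qed
  then show "[int (f x i) = int (x i)] (mod int p)"
    using AGL_linear[OF f' xV i] i by simp
qed

lemma frame_stab_full: "frame_stab d = {id}"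
proof (intro equalityI subsetI)
  fix f assume f: "f \<in> frame_stab d"
  have "f x = x" for x
    using frame_stab_fixes[OF f order_refl] coord_subspace_full
      permutes_not_in[OF perm_groupD(1)[OF frame_stab_group f]] by blast
  then show "f \<in> {id}" by auto
qed (use perm_groupD(2)[OF frame_stab_group] in auto)

text \<open>By injectivity \<open>unit_vec k\<close> cannot enter the span of the earlier unit
  vectors, which is fixed pointwise. Conversely, any vector outside that span can be column
  \<open>k\<close> of an invertible matrix whose earlier columns are those of the identity.\<close>

lemma frame_stab_orbit:
  assumes k: "k < d"
  shows "(\<lambda>f. f (unit_vec k)) ` frame_stab k = V - coord_subspace {..<k}"
proof (intro equalityI subsetI)
  fix v assume "v \<in> (\<lambda>f. f (unit_vec k)) ` frame_stab k"
  then obtain f where f: "f \<in> frame_stab k" "v = f (unit_vec k)" by blast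
  have fp: "f permutes V" using perm_groupD(1)[OF frame_stab_group f(1)] .
  have "v \<notin> coord_subspace {..<k}"
  proof
    assume v: "v \<in> coord_subspace {..<k}"
    then have "f v = f (unit_vec k)" using frame_stab_fixes[OF f(1)] f(2) k by simp
    then have "v = unit_vec k" using permutes_inj[OF fp] injD by metis
    then show False using v unfolding coord_subspace_def unit_vec_def by force
  qed
  then show "v \<in> V - coord_subspace {..<k}" using f permutes_in[OF fp unit_vec_in[OF k]] by simp
next
  fix v assume v: "v \<in> V - coord_subspace {..<k}"
  then have vV: "v \<in> V" by blast
  have col: "colmap j u \<in> frame_stab k" if "k \<le> j" "j < d" "u \<in> V" "u j \<noteq> 0" for j u
    unfolding frame_stab_def using that colmap_AGL
    by (auto simp: zero_vec_def unit_vec_def intro!: colmap_fix)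
  from v obtain i where i: "i \<ge> k" "v i \<noteq> 0" unfolding coord_subspace_def by (auto simp: not_less)
  have id: "i < d" using i Vec_0[OF vV] by (metis linorder_not_le)
  show "v \<in> (\<lambda>f. f (unit_vec k)) ` frame_stab k"
  proof (cases "v k = 0")
    case False
    then show ?thesis using col[of k v] colmap_unit_vec[OF k vV] k vV by (metis order_refl image_eqI)
  next
    case True
    then have ik: "i \<noteq> k" using i by blast
    \<comment> \<open>adding coordinate i to coordinate k reduces to the previous case\<close>
    define t where "t = colmap i (\<lambda>l. if l = i \<or> l = k then 1 else 0)"
    have t: "t \<in> frame_stab k" unfolding t_def
      using i id k p_gt_2 by (intro col VecI) auto
    have tp: "t permutes V" using perm_groupD(1)[OF frame_stab_group t] .
    have tv: "t v \<in> V" using permutes_in[OF tp vV] .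
    have "t v k = v i" unfolding t_def colmap_def using vV True ik Vec_less[OF vV] by simp
    then have c: "colmap k (t v) \<in> frame_stab k" using col[of k "t v"] k tv i by simp
    have "(inv t \<circ> colmap k (t v)) (unit_vec k) = v"
      using colmap_unit_vec[OF k tv] permutes_inverses[OF tp] by simp
    moreover have "inv t \<circ> colmap k (t v) \<in> frame_stab k"
      using perm_groupD(3,4)[OF frame_stab_group] t c by blast
    ultimately show ?thesis by (metis image_eqI)
  qed
qed

lemma card_frame_stab:
  assumes "k < d"
  shows "card (frame_stab k) = (p ^ d - p ^ k) * card (frame_stab (Suc k))"
proof -
  have "{f\<in>frame_stab k. f (unit_vec k) = unit_vec k} = frame_stab (Suc k)"
    unfolding frame_stab_def by (auto simp: less_Suc_eq)
  moreover have "card (V - coord_subspace {..<k}) = p ^ d - p ^ k"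
    using card_coord_subspace[of "{..<k}"] assms card_V finite_V
    by (subst card_Diff_subset) (auto simp: coord_subspace_def intro: finite_subset)
  ultimately show ?thesis
    using perm_group_orbit_stabiliser[OF finite_V frame_stab_group, of k "unit_vec k"]
    by (simp add: frame_stab_orbit[OF assms])
qed

lemma card_AGL: "card (AGL d p) = p ^ d * (\<Prod>k<d. p ^ d - p ^ k)"
proof -
  have "card (frame_stab 0) = (\<Prod>l<k. p ^ d - p ^ l) * card (frame_stab k)" if "k \<le> d" for k
    using that by (induction k) (simp_all add: card_frame_stab)
  from this[of d] have s0: "card (frame_stab 0) = (\<Prod>l<d. p ^ d - p ^ l)"
    by (simp add: frame_stab_full)
  have "(\<lambda>f. f zero_vec) ` AGL d p = V"
  proof (intro equalityI subsetI)
    fix v assume "v \<in> V"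
    then show "v \<in> (\<lambda>f. f zero_vec) ` AGL d p"
      by (intro image_eqI[of _ _ "transl v"]) (simp_all add: transl_AGL transl_zero)
  next
    fix v assume "v \<in> (\<lambda>f. f zero_vec) ` AGL d p"
    then show "v \<in> V" using AGL_in[OF _ zero_vec_in] by blast
  qed
  moreover have "{f\<in>AGL d p. f zero_vec = zero_vec} = frame_stab 0"
    unfolding frame_stab_def by simp
  ultimately show ?thesis
    using perm_group_orbit_stabiliser[OF finite_V AGL_group, of zero_vec] s0 card_V by simp
qed

lemma bigOmega_card_AGL:
  "bigOmega (card (AGL d p)) = d + (\<Sum>k<d. k + bigOmega (p ^ (d - k) - 1))"
proof -
  have fac: "p ^ d - p ^ k = p ^ k * (p ^ (d - k) - 1)" if "k < d" for k
    using that by (simp add: diff_mult_distrib2 flip: power_add)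
  have nz: "p ^ (d - k) - 1 \<noteq> 0" if "k < d" for k
    using that p_gt_2 one_less_power[of p "d - k"] by auto
  have "bigOmega (\<Prod>k<d. p ^ d - p ^ k) = (\<Sum>k<d. bigOmega (p ^ d - p ^ k))"
    using nz by (intro bigOmega_prod) (auto simp: fac)
  also have "\<dots> = (\<Sum>k<d. k + bigOmega (p ^ (d - k) - 1))"
    using nz prime_p by (intro sum.cong refl) (simp add: fac bigOmega_mult bigOmega_power)
  finally show ?thesis unfolding card_AGL
    using nz prime_p by (subst bigOmega_mult) (auto simp: fac bigOmega_power)
qed

text \<open>The powers of \<open>p\<close> in the order contribute
  \<open>d + d * (d - 1) / 2 = d * (d + 1) / 2\<close> prime factors. Each \<open>p ^ m - 1\<close>
  with \<open>1 \<le> m \<le> d\<close> contributes fewer than \<open>m * log 2 p\<close>, strictly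
  because of the subtracted 1, and these \<open>m\<close> again sum to
  \<open>d * (d + 1) / 2\<close>.\<close>

lemma bigOmega_card_AGL_less:
  "real (bigOmega (card (AGL d p))) < real (d * (d + 1)) / 2 * (1 + log 2 (real p))"
proof -
  have g: "(\<Sum>k<d. real k) = real d * (real d - 1) / 2"
    by (induction d) (auto simp: field_simps)
  have "real (bigOmega (p ^ (d - k) - 1)) < (real d - real k) * log 2 (real p)" if "k < d" for k
  proof -
    let ?m = "p ^ (d - k) - 1"
    have m: "?m > 0" using that p_gt_2 one_less_power[of p "d - k"] by simp
    have "2 ^ bigOmega ?m < p ^ (d - k)"
      using two_power_bigOmega_le[OF m] m by linarith
    then have "(2::real) ^ bigOmega ?m < real p ^ (d - k)"
      by (metis of_nat_less_iff of_nat_numeral of_nat_power)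
    then have "log 2 (2 ^ bigOmega ?m) < log 2 (real p ^ (d - k))" by (subst log_less_cancel_iff) auto
    then show ?thesis using that by (simp add: log_nat_power of_nat_diff)
  qed
  then have "(\<Sum>k<d. real (bigOmega (p ^ (d - k) - 1))) < (\<Sum>k<d. (real d - real k) * log 2 (real p))"
    using d_pos by (intro sum_strict_mono) auto
  also have "\<dots> = (\<Sum>k<d. real d - real k) * log 2 (real p)"
    by (simp add: sum_distrib_right)
  also have "(\<Sum>k<d. real d - real k) = real d * (real d + 1) / 2"
    by (simp add: sum_subtractf g field_simps)
  finally have "(\<Sum>k<d. real (bigOmega (p ^ (d - k) - 1))) < real d * (real d + 1) / 2 * log 2 (real p)" .
  then show ?thesis unfolding bigOmega_card_AGL
    by (simp add: sum.distrib g) (simp add: field_simps)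
qed

section \<open>An odd affine permutation\<close>

lemma primitive_root:
  obtains w where "coprime p w" "w < p" "w \<noteq> 0" "ord p w = p - 1"
proof -
  obtain w where "w \<in> totatives p" "ord p w = p - 1"
    using residue_prime_has_primroot[OF prime_p] by blast
  then show thesis using that[of w] p_gt_2 by (auto simp: totatives_less coprime_commute in_totatives_iff)
qed

text \<open>Multiplying coordinate 0 by a primitive root permutes the vectors with nonzero
  coordinate 0 in cycles of the even length \<open>p - 1\<close>. There is one cycle for each choice
  of the other coordinates, hence the odd number \<open>p ^ (d - 1)\<close> of them.\<close>

lemma odd_AGL:
  obtains h where "h \<in> AGL d p" "\<not> evenperm h"
proof -
  obtain w where w: "coprime p w" "w < p" "w \<noteq> 0" "ord p w = p - 1" using primitive_root by blast
  define v where "v = (\<lambda>i::nat. if i = 0 then w else 0)"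
  define f where "f = colmap 0 v"
  have vV: "v \<in> V" unfolding v_def using w d_pos by (intro VecI) auto
  have fA: "f \<in> AGL d p" unfolding f_def using w d_pos vV by (intro colmap_AGL) (auto simp: v_def)
  have fx: "f x = x(0 := x 0 * w mod p)" if "x \<in> V" for x
    unfolding f_def colmap_def v_def using that Vec_less[OF that] by auto
  \<comment> \<open>Every cycle has exactly one member with coordinate 0 equal to 1; it serves as
    the representative.\<close>
  define R where "R = {x\<in>V. x 0 = 1}"
  define cyc where "cyc r = map (\<lambda>m. r(0 := w ^ m mod p)) [0..<p - 1]" for r :: "nat \<Rightarrow> nat"
  have inj: "inj_on (\<lambda>m. w ^ m mod p) {..<p - 1}" using inj_power_mod[OF w(1)] w(4) by simp
  have ne0: "w ^ m mod p \<noteq> 0" for m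
    using w(1) prime_p by (metis coprime_absorb_left coprime_power_right_iff dvd_eq_mod_eq_0 not_prime_unit)
  have "(\<lambda>m. w ^ m mod p) ` {..<p - 1} = {0<..<p}"
    by (rule card_subset_eq) (use ne0 card_image[OF inj] in auto)
  then have surj: "\<exists>m<p - 1. w ^ m mod p = a" if "0 < a" "a < p" for a
    using that by (metis (no_types, lifting) greaterThanLessThan_iff imageE lessThan_iff)
  have cycV: "x \<in> V" if "x \<in> set (cyc r)" "r \<in> R" for x r
    using that d_pos unfolding cyc_def R_def by (auto intro!: VecI simp: Vec_less Vec_0)
  have "permutation f \<and> (evenperm f \<longleftrightarrow> even (card R))"
  proof (rule evenperm_product_of_even_cycles[where n = "p - 1" and cyc = cyc])
    show "finite R" unfolding R_def using finite_V by simp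
    show "even (p - 1)" "p - 1 > 0" using odd_p p_gt_2 by auto
    show "distinct (cyc r) \<and> length (cyc r) = p - 1" for r
      unfolding cyc_def distinct_map using inj by (auto simp: inj_on_def fun_upd_eqD)
  next
    fix r s assume rs: "r \<in> R" "s \<in> R" "r \<noteq> s"
    show "set (cyc r) \<inter> set (cyc s) = {}"
    proof (rule ccontr)
      assume "set (cyc r) \<inter> set (cyc s) \<noteq> {}"
      then obtain m n where e: "r(0 := w ^ m mod p) = s(0 := w ^ n mod p)" unfolding cyc_def by auto
      have "r i = s i" for i
        using fun_cong[OF e, of i] rs unfolding R_def by (cases "i = 0") auto
      then show False using rs(3) by blast
    qed
  next
    fix r i assume r: "r \<in> R" and i: "i < p - 1"
    have V: "cyc r ! i \<in> V" using cycV[OF _ r] i unfolding cyc_def by simp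
    have "w ^ i mod p * w mod p = w ^ Suc i mod p" by (metis mod_mult_left_eq mult.commute power_Suc)
    also have "\<dots> = w ^ (Suc i mod (p - 1)) mod p"
    proof (cases "Suc i = p - 1")
      case True
      have "[w ^ (p - 1) = 1] (mod p)" using ord[of w p] w(4) by simp
      then show ?thesis using True by (simp add: cong_def)
    qed (use i in simp)
    finally have step: "w ^ i mod p * w mod p = w ^ (Suc i mod (p - 1)) mod p" .
    have "Suc i mod (p - 1) < p - 1" using p_gt_2 by simp
    then show "f (cyc r ! i) = cyc r ! (Suc i mod (p - 1))"
      using fx[OF V] i step unfolding cyc_def by simp
  next
    fix x assume n: "\<And>r. r \<in> R \<Longrightarrow> x \<notin> set (cyc r)"
    show "f x = x"
    proof (cases "x \<in> V \<and> x 0 \<noteq> 0")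
      case True
      then obtain m where m: "m < p - 1" "w ^ m mod p = x 0" using surj[of "x 0"] Vec_less[of x 0] by auto
      have "x(0 := 1) \<in> R" unfolding R_def using True p_gt_2 d_pos
        by (auto intro!: VecI simp: Vec_less Vec_0)
      moreover have "x \<in> set (cyc (x(0 := 1)))" unfolding cyc_def using m
        by (auto intro!: image_eqI[of _ _ m])
      ultimately show ?thesis using n by blast
    next
      case False
      then show ?thesis using fx unfolding f_def colmap_def by (auto simp: fun_eq_iff Vec_less)
    qed
  qed
  moreover have "card R = p ^ (d - 1)"
  proof -
    have "bij_betw (\<lambda>x. x(0 := 0)) R (coord_subspace {1..<d})"
    proof (rule bij_betw_byWitness[where f' = "\<lambda>x. x(0 := 1)"])
      show "(\<lambda>x. x(0 := 0)) ` R \<subseteq> coord_subspace {1..<d}"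
        unfolding R_def coord_subspace_def by (auto intro!: VecI simp: Vec_less Vec_0)
      show "(\<lambda>x. x(0 := 1)) ` coord_subspace {1..<d} \<subseteq> R"
        unfolding R_def coord_subspace_def using p_gt_2 d_pos by (auto intro!: VecI simp: Vec_less Vec_0)
    qed (auto simp: R_def coord_subspace_def)
    then have "card R = card (coord_subspace {1..<d})" by (rule bij_betw_same_card)
    also have "\<dots> = p ^ (d - 1)" by (subst card_coord_subspace) auto
    finally show ?thesis .
  qed
  ultimately have "\<not> evenperm f" using odd_p by simp
  then show thesis using that fA by blast
qed

section \<open>From the affine group to the diagonal group\<close>

definition smul :: "nat \<Rightarrow> (nat \<Rightarrow> nat) \<Rightarrow> nat \<Rightarrow> nat" where
  "smul k x = (\<lambda>i. (k * x i) mod p)"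

lemma smul_in: "x \<in> V \<Longrightarrow> smul k x \<in> V"
  unfolding smul_def by (intro VecI) (auto simp: Vec_0)

lemma smul_eq_shift: "smul k x = shift zero_vec k zero_vec x"
  unfolding smul_def shift_def zero_vec_def by (simp add: algebra_simps)

lemma AGL_smul:
  assumes "f \<in> AGL d p" "f zero_vec = zero_vec" "x \<in> V"
  shows "f (smul k x) = smul k (f x)"
  unfolding smul_eq_shift using AGL_shift[OF assms(1) zero_vec_in zero_vec_in assms(3)] assms(2) by simp

lemma mult_mod_p_eq_0:
  assumes "(a * b) mod p = 0" "a < p" "b < p" shows "a = 0 \<or> b = 0"
  using assms prime_p by (metis dvd_eq_mod_eq_0 nat_dvd_not_less neq0_conv prime_dvd_mult_nat)

lemma smul_inj:
  assumes "x \<in> V" "y \<in> V" "smul c x = smul c y" "c < p" "c \<noteq> 0"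
  shows "x = y"
proof (rule Vec_eqI[OF assms(1,2)])
  fix i
  have "[x i * c = y i * c] (mod p)" using fun_cong[OF assms(3), of i]
    unfolding smul_def cong_def by (simp add: mult.commute)
  then have "[int (x i) * int c = int (y i) * int c] (mod int p)"
    by (metis cong_int_iff of_nat_mult)
  then show "[int (x i) = int (y i)] (mod int p)" using cong_mult_cancel assms(4,5) by blast
qed

section \<open>Scalar multiplication on a part of the space\<close>

definition scale_on :: "(nat \<Rightarrow> nat) set \<Rightarrow> nat \<Rightarrow> (nat \<Rightarrow> nat) \<Rightarrow> nat \<Rightarrow> nat" where
  "scale_on T c x = (if x \<in> T then smul c x else x)"

lemma scale_on_permutes:
  assumes T: "T \<subseteq> V" "\<And>x. x \<in> T \<Longrightarrow> smul c x \<in> T" and c: "c < p" "c \<noteq> 0"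
  shows "scale_on T c permutes V"
proof (rule inj_imp_permutes)
  show "inj_on (scale_on T c) V"
  proof (rule inj_onI)
    fix x y assume "x \<in> V" "y \<in> V" "scale_on T c x = scale_on T c y"
    then show "x = y" using T(2) smul_inj[OF _ _ _ c, of x y] unfolding scale_on_def
      by (metis (full_types))
  qed
  show "scale_on T c x \<in> V" if "x \<in> V" for x
    using that smul_in unfolding scale_on_def by simp
  show "scale_on T c x = x" if "x \<notin> V" for x
    using that T(1) unfolding scale_on_def by auto
qed (rule finite_V)

text \<open>A linear map commutes with scalars, so only the invariance of \<open>T\<close>
  matters.\<close>

lemma scale_on_commute:
  assumes f: "f \<in> AGL d p" "f zero_vec = zero_vec" and T: "T \<subseteq> V" "\<And>x. x \<in> V \<Longrightarrow> f x \<in> T \<longleftrightarrow> x \<in> T"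
  shows "scale_on T c \<circ> f = f \<circ> scale_on T c"
proof
  fix x show "(scale_on T c \<circ> f) x = (f \<circ> scale_on T c) x"
  proof (cases "x \<in> V")
    case True
    then show ?thesis using T AGL_smul[OF f True] unfolding scale_on_def by simp
  next
    case False
    then have "f x = x" using permutes_not_in[OF AGL_permutes[OF f(1)]] by blast
    moreover have "x \<notin> T" using False T(1) by blast
    ultimately show ?thesis unfolding scale_on_def by simp
  qed
qed

lemma smul_coord_subspace: "x \<in> coord_subspace S \<Longrightarrow> smul c x \<in> coord_subspace S"
  unfolding coord_subspace_def using smul_in by (simp add: smul_def)

definition neg_on :: "nat set \<Rightarrow> (nat \<Rightarrow> nat) \<Rightarrow> nat \<Rightarrow> nat" where
  "neg_on S = scale_on (coord_subspace S) (p - 1)"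

lemma small_neg_on:
  assumes S: "S \<subset> {..<d}"
  shows "small (neg_on S)"
  unfolding small_def
proof
  show "neg_on S permutes V" unfolding neg_on_def
    by (rule scale_on_permutes) (use smul_coord_subspace p_gt_2 in \<open>auto simp: coord_subspace_def\<close>)
  have fin: "finite (coord_subspace S)" unfolding coord_subspace_def using finite_V by simp
  have z: "zero_vec \<in> coord_subspace S" unfolding coord_subspace_def using zero_vec_in by (simp add: zero_vec_def)
  \<comment> \<open>Leaving out the fixed vector 0 is essential: for \<open>p = 3\<close>, twice
    \<open>p ^ (d - 1)\<close> equals \<open>p ^ d - p ^ (d - 1)\<close>, and the strict inequality
    would fail when \<open>card S = d - 1\<close>.\<close>
  have "{x. neg_on S x \<noteq> x} \<subseteq> coord_subspace S - {zero_vec}"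
    unfolding neg_on_def scale_on_def by (auto simp: smul_def zero_vec_def split: if_splits)
  then have "card {x. neg_on S x \<noteq> x} \<le> card (coord_subspace S - {zero_vec})"
    using fin by (intro card_mono) auto
  also have "\<dots> = p ^ card S - 1" using fin z card_coord_subspace S by (simp add: psubset_imp_subset)
  finally have le: "card {x. neg_on S x \<noteq> x} \<le> p ^ card S - 1" .
  have "card S < d" using psubset_card_mono[OF finite_lessThan S] by simp
  then have "p ^ card S \<le> p ^ (d - 1)" using p_gt_2 by (intro power_increasing) auto
  moreover have "p ^ d - p ^ (d - 1) \<ge> 2 * p ^ (d - 1)"
  proof -
    have "p ^ d = p * p ^ (d - 1)" using d_pos by (simp add: power_eq_if)
    moreover have "3 * p ^ (d - 1) \<le> p * p ^ (d - 1)" using p_gt_2 by (intro mult_le_mono) auto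
    ultimately show ?thesis by linarith
  qed
  moreover have "p ^ (d - 1) > 0" "p ^ card S > 0" by auto
  ultimately show "2 * card {x. neg_on S x \<noteq> x} < p ^ d - p ^ (d - 1)" using le by linarith
qed

text \<open>As \<open>p\<close> is odd, \<open>neg_on S\<close> moves precisely the nonzero vectors
  of its subspace. For nonempty \<open>S \<subseteq> {..<d}\<close>, an affine map therefore
  commutes with it iff it fixes 0 and preserves the subspace.\<close>

definition flag_stab :: "nat set set \<Rightarrow> ((nat \<Rightarrow> nat) \<Rightarrow> nat \<Rightarrow> nat) set" where
  "flag_stab \<S> = {f \<in> AGL d p. \<forall>S\<in>\<S>. neg_on S \<circ> f = f \<circ> neg_on S}"

definition transvection :: "nat \<Rightarrow> nat \<Rightarrow> (nat \<Rightarrow> nat) \<Rightarrow> nat \<Rightarrow> nat" where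
  "transvection i j = colmap j (\<lambda>l. if l = j \<or> l = i then 1 else 0)"

lemma transvection_AGL: "i < d \<Longrightarrow> j < d \<Longrightarrow> transvection i j \<in> AGL d p"
  unfolding transvection_def using p_gt_2 by (intro colmap_AGL VecI) auto

lemma transvection_apply:
  assumes "x \<in> V" "i \<noteq> j"
  shows "transvection i j x = x(i := (x i + x j) mod p)"
  unfolding transvection_def colmap_def using assms Vec_less[OF assms(1)] by (auto simp: fun_eq_iff)

text \<open>Strictness is witnessed by the transvection taking \<open>unit_vec j\<close> to its sum
  with \<open>unit_vec i\<close>. It preserves the subspace of \<open>S'\<close> whenever
  \<open>j \<in> S'\<close> implies \<open>i \<in> S'\<close>, but it moves
  \<open>unit_vec j\<close> out of the subspace of \<open>S\<close>.\<close>

lemma base_step_flag_stab: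
  assumes S: "S \<subset> {..<d}" and ij: "i < d" "j < d" "j \<in> S" "i \<notin> S"
    and closed: "\<And>S'. S' \<in> \<S> \<Longrightarrow> j \<in> S' \<Longrightarrow> i \<in> S'"
  shows "base_step V (AGL d p) (Sym V) (flag_stab \<S>) (flag_stab (insert S \<S>))"
proof -
  let ?t = "transvection i j"
  have neq: "i \<noteq> j" using ij by blast
  have tA: "?t \<in> AGL d p" using transvection_AGL ij by blast
  have "neg_on S' \<circ> ?t = ?t \<circ> neg_on S'" if "S' \<in> \<S>" for S'
    unfolding neg_on_def
  proof (rule scale_on_commute[OF tA])
    show "?t zero_vec = zero_vec"
      using transvection_apply[OF zero_vec_in neq] by (auto simp: zero_vec_def fun_eq_iff)
    show "coord_subspace S' \<subseteq> V" unfolding coord_subspace_def by blast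
    fix x assume x: "x \<in> V"
    have tx: "?t x = x(i := (x i + x j) mod p)" using transvection_apply[OF x neq] .
    have txV: "?t x \<in> V" using AGL_in tA x by blast
    show "?t x \<in> coord_subspace S' \<longleftrightarrow> x \<in> coord_subspace S'"
    proof (cases "i \<in> S'")
      case True
      then show ?thesis using x txV unfolding coord_subspace_def tx by auto
    next
      case False
      then have j: "j \<notin> S'" using closed that by blast
      have "?t x = x" if "x j = 0" using tx that Vec_less[OF x] by (auto simp: fun_eq_iff)
      moreover have "?t x j = x j" using tx neq by simp
      ultimately show ?thesis using j x txV unfolding coord_subspace_def by auto
    qed
  qed
  then have t1: "?t \<in> flag_stab \<S>" unfolding flag_stab_def using tA by blast
  have t2: "?t \<notin> flag_stab (insert S \<S>)"
  proof
    assume "?t \<in> flag_stab (insert S \<S>)"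
    then have c: "neg_on S (?t (unit_vec j)) = ?t (neg_on S (unit_vec j))"
      unfolding flag_stab_def by (auto dest: fun_cong)
    have te: "?t (unit_vec j) = (unit_vec j)(i := 1)"
      using transvection_apply[OF unit_vec_in[OF ij(2)] neq] p_gt_2 neq by (auto simp: unit_vec_def fun_eq_iff)
    have "?t (unit_vec j) \<notin> coord_subspace S"
      unfolding te coord_subspace_def using ij by auto
    then have "neg_on S (?t (unit_vec j)) j = 1"
      unfolding neg_on_def scale_on_def te using neq by (simp add: unit_vec_def)
    moreover have "unit_vec j \<in> coord_subspace S"
      unfolding coord_subspace_def using ij unit_vec_in by (auto simp: unit_vec_def)
    then have "neg_on S (unit_vec j) = smul (p - 1) (unit_vec j)"
      unfolding neg_on_def scale_on_def by simp
    then have "?t (neg_on S (unit_vec j)) j = smul (p - 1) (unit_vec j) j"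
      using transvection_apply[OF smul_in[OF unit_vec_in[OF ij(2)]] neq] neq by simp
    then have "?t (neg_on S (unit_vec j)) j = p - 1"
      using p_gt_2 by (simp add: smul_def unit_vec_def)
    ultimately show False using c p_gt_2 by simp
  qed
  have g: "small (neg_on S)" using small_neg_on[OF S] .
  have "flag_stab (insert S \<S>) = flag_stab \<S> \<inter> conj_stab V (AGL d p) (neg_on S)"
    unfolding flag_stab_def using conj_stab_small_iff[OF g] by auto
  moreover have "flag_stab (insert S \<S>) \<subset> flag_stab \<S>" using t1 t2 unfolding flag_stab_def by blast
  moreover have "neg_on S \<in> Sym V" using g unfolding small_def Sym_def by blast
  ultimately show ?thesis unfolding base_step_def by blast
qed

section \<open>The diagonal group as a stabiliser of subspaces\<close>

definition diag :: "((nat \<Rightarrow> nat) \<Rightarrow> nat \<Rightarrow> nat) set" where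
  "diag = {f \<in> AGL d p. f zero_vec = zero_vec \<and> (\<forall>j<d. \<forall>i. i \<noteq> j \<longrightarrow> f (unit_vec j) i = 0)}"

lemma diag_apply:
  assumes f: "f \<in> diag" and x: "x \<in> V"
  shows "f x i = (f (unit_vec i) i * x i) mod p"
proof (cases "i < d")
  case True
  have f': "f \<in> AGL d p" "f zero_vec = zero_vec" using f unfolding diag_def by auto
  have "(\<Sum>j<d. int (f (unit_vec j) i) * int (x j)) =
      (\<Sum>j<d. if j = i then int (f (unit_vec i) i) * int (x i) else 0)"
    using f unfolding diag_def by (intro sum.cong refl) auto
  then have "[int (f x i) = int (f (unit_vec i) i * x i)] (mod int p)"
    using AGL_linear[OF f' x True] True by simp
  then have "[f x i = f (unit_vec i) i * x i] (mod p)" using cong_int_iff by blast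
  then show ?thesis using Vec_less[OF AGL_in[OF f'(1) x], of i] by (simp add: cong_def)
next
  case False
  then have "x i = 0" "f x i = 0"
    using Vec_0[OF x] Vec_0[OF AGL_in[OF _ x, of f]] f unfolding diag_def by auto
  then show ?thesis by simp
qed

lemma diag_entry:
  assumes f: "f \<in> diag" and i: "i < d"
  shows "f (unit_vec i) i < p" "f (unit_vec i) i \<noteq> 0"
proof -
  have fA: "f \<in> AGL d p" and f0: "f zero_vec = zero_vec" using f unfolding diag_def by auto
  show "f (unit_vec i) i < p" using Vec_less AGL_in fA unit_vec_in i by blast
  show "f (unit_vec i) i \<noteq> 0"
  proof
    assume 0: "f (unit_vec i) i = 0"
    have "f (unit_vec i) j = 0" for j using f i 0 unfolding diag_def by (cases "j = i") auto
    then have "f (unit_vec i) = zero_vec" unfolding zero_vec_def by blast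
    then have "f (unit_vec i) = f zero_vec" using f0 by simp
    then have "unit_vec i = zero_vec" using permutes_inj[OF AGL_permutes[OF fA]] injD by metis
    then show False unfolding unit_vec_def zero_vec_def by (metis zero_neq_one)
  qed
qed

lemma diag_eq_0_iff:
  assumes "f \<in> diag" "x \<in> V"
  shows "f x i = 0 \<longleftrightarrow> x i = 0"
proof (cases "i < d")
  case True
  then show ?thesis unfolding diag_apply[OF assms]
    using diag_entry[OF assms(1) True] mult_mod_p_eq_0[of "f (unit_vec i) i" "x i"] Vec_less[OF assms(2), of i] by auto
next
  case False
  then show ?thesis
    using Vec_0[OF assms(2)] Vec_0[OF AGL_in[OF _ assms(2), of f]] assms(1) unfolding diag_def by auto
qed

lemma diag_coord_subspace:
  assumes "f \<in> diag" "x \<in> V"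
  shows "f x \<in> coord_subspace S \<longleftrightarrow> x \<in> coord_subspace S"
  unfolding coord_subspace_def using diag_eq_0_iff[OF assms] assms AGL_in[OF _ assms(2), of f] by (auto simp: diag_def)

text \<open>Preserving every coordinate axis forces a diagonal matrix. Diagonal maps in turn
  preserve every coordinate subspace, so further members of the family cannot shrink the
  group.\<close>

lemma flag_stab_eq_diag:
  assumes "\<And>j. j < d \<Longrightarrow> {j} \<in> \<S>"
  shows "flag_stab \<S> = diag"
proof (intro equalityI subsetI)
  fix f assume f: "f \<in> flag_stab \<S>"
  then have fA: "f \<in> AGL d p" unfolding flag_stab_def by blast
  have main: "f (unit_vec j) \<in> coord_subspace {j}" "f zero_vec = zero_vec" if j: "j < d" for j
  proof -
    let ?e = "unit_vec j" and ?m = "smul (p - 1) (unit_vec j)"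
    have eV: "?e \<in> V" using unit_vec_in j by blast
    have "neg_on {j} \<circ> f = f \<circ> neg_on {j}" using f assms j unfolding flag_stab_def by blast
    then have c: "neg_on {j} (f ?e) = f (neg_on {j} ?e)" by (auto dest: fun_cong)
    have "?e \<in> coord_subspace {j}" using eV by (auto simp: coord_subspace_def unit_vec_def)
    then have n: "neg_on {j} ?e = ?m" unfolding neg_on_def scale_on_def by simp
    show W: "f ?e \<in> coord_subspace {j}"
    proof (rule ccontr)
      assume "f ?e \<notin> coord_subspace {j}"
      then have "f ?e = f ?m" using c n unfolding neg_on_def scale_on_def by simp
      then have "?e = ?m" using permutes_inj[OF AGL_permutes[OF fA]] injD by metis
      from fun_cong[OF this, of j] show False using p_gt_2 by (simp add: smul_def unit_vec_def)
    qed
    \<comment> \<open>For affine \<open>f\<close> the value at the negative of \<open>?e\<close> is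
      \<open>2 * f zero_vec - f ?e\<close>. Equating it with the negative of \<open>f ?e\<close>
      leaves \<open>2 * f zero_vec = 0\<close>, and 2 is invertible.\<close>
    then have e: "smul (p - 1) (f ?e) = shift (f zero_vec) (p - 1) (f zero_vec) (f ?e)"
      using c n AGL_shift[OF fA zero_vec_in zero_vec_in eV] unfolding neg_on_def scale_on_def smul_eq_shift by simp
    have zV: "f zero_vec \<in> V" using AGL_in fA by simp
    show "f zero_vec = zero_vec"
    proof (rule Vec_eqI[OF zV zero_vec_in])
      fix i
      have "[int (smul (p - 1) (f ?e) i) = int (p - 1) * int (f ?e i)] (mod int p)"
        using shift_cong[OF zero_vec_in, of zero_vec "p - 1" "f ?e" i]
        unfolding smul_eq_shift by (simp add: zero_vec_def)
      then have "[int (p - 1) * int (f ?e i) =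
          int (f zero_vec i) + int (p - 1) * (int (f ?e i) - int (f zero_vec i))] (mod int p)"
        using shift_cong[OF zV, of "f zero_vec" "p - 1" "f ?e" i] unfolding e by (metis cong_sym cong_trans)
      then have "int p dvd int (p - 1) * int (f zero_vec i) - int (f zero_vec i)"
        by (simp add: cong_iff_dvd_diff algebra_simps)
      moreover have "int (p - 1) * int (f zero_vec i) - int (f zero_vec i) =
          int p * int (f zero_vec i) - 2 * int (f zero_vec i)"
        using p_gt_2 by (simp add: of_nat_diff algebra_simps)
      ultimately have "int p dvd 2 * int (f zero_vec i)"
        by (metis dvd_diff_right_iff dvd_triv_left)
      then have "p dvd 2 * f zero_vec i" by (metis int_dvd_int_iff of_nat_mult of_nat_numeral)
      then have "p dvd f zero_vec i"
        using prime_p p_gt_2 by (metis nat_dvd_not_less pos2 prime_dvd_mult_nat)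
      then show "[int (f zero_vec i) = int (zero_vec i)] (mod int p)"
        by (simp add: zero_vec_def cong_0_iff)
    qed
  qed
  then show "f \<in> diag" using fA main(2)[OF d_pos] main(1) unfolding diag_def coord_subspace_def by auto
next
  fix f assume f: "f \<in> diag"
  then have "neg_on S \<circ> f = f \<circ> neg_on S" for S
    unfolding neg_on_def using diag_coord_subspace[OF f]
    by (intro scale_on_commute) (auto simp: diag_def coord_subspace_def)
  then show "f \<in> flag_stab \<S>" using f unfolding flag_stab_def diag_def by blast
qed

text \<open>In matrix terms the flag \<open>F (d - 1)\<close> leaves the invertible upper triangular
  matrices. Preserving the span of \<open>unit_vec j\<close> and the unit vectors of index below
  \<open>i\<close> then makes the entries of column \<open>j\<close> in rows \<open>i\<close> to
  \<open>j - 1\<close> vanish. Taking \<open>i\<close> downwards clears one entry per step, whereas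
  the axis alone would clear the column at once.\<close>

lemma relpowp_AGL_diag:
  assumes d2: "d \<ge> 2"
  shows "(base_step V (AGL d p) (Sym V) ^^ (d - 1 + d * (d - 1) div 2)) (AGL d p) diag"
proof -
  let ?st = "base_step V (AGL d p) (Sym V)"
  define F where "F k = {{..<l} | l. 1 \<le> l \<and> l \<le> k}" for k :: nat
  have F: "(?st ^^ k) (AGL d p) (flag_stab (F k))" if "k \<le> d - 1" for k
    using that
  proof (induction k)
    case 0
    then show ?case unfolding F_def flag_stab_def by simp
  next
    case (Suc k)
    \<comment> \<open>No member of \<open>F k\<close> contains \<open>k\<close>, so the closure
      condition is vacuous. Row \<open>Suc k\<close> exists because the flag stops at dimension
      \<open>d - 1\<close>.\<close>
    have "?st (flag_stab (F k)) (flag_stab (insert {..<Suc k} (F k)))"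
      by (rule base_step_flag_stab[where i = "Suc k" and j = k]) (use Suc.prems in \<open>auto simp: F_def\<close>)
    moreover have "insert {..<Suc k} (F k) = F (Suc k)" unfolding F_def by (auto simp: le_Suc_eq)
    ultimately show ?case using Suc by auto
  qed
  \<comment> \<open>\<open>Q j\<close> stands for the columns before \<open>j\<close> being cleared,
    and \<open>Qc j m\<close> for clearing in addition the \<open>m\<close> entries of column
    \<open>j\<close> next above the diagonal.\<close>
  define Q where "Q j = F (d - 1) \<union> (\<Union>b<j. (\<lambda>a. insert b {..<a}) ` {..<b})" for j
  define Qc where "Qc j m = Q j \<union> (\<lambda>a. insert j {..<a}) ` {j - m..<j}" for j m
  have col: "(?st ^^ m) (flag_stab (Q j)) (flag_stab (Qc j m))" if "j < d" "m \<le> j" for j m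
    using that(2)
  proof (induction m)
    case 0
    have "Qc j 0 = Q j" unfolding Qc_def by auto
    then show ?case by simp
  next
    case (Suc m)
    define i where "i = j - Suc m"
    have i: "i < j" "j - m = Suc i" using Suc.prems unfolding i_def by auto
    have "?st (flag_stab (Qc j m)) (flag_stab (insert (insert j {..<i}) (Qc j m)))"
    proof (rule base_step_flag_stab[where i = i and j = j])
      have "i \<notin> insert j {..<i}" "i \<in> {..<d}" "insert j {..<i} \<subseteq> {..<d}" using i that by auto
      then show "insert j {..<i} \<subset> {..<d}" by blast
      fix S' assume S': "S' \<in> Qc j m" "j \<in> S'"
      then consider l where "S' = {..<l}" | a b where "S' = insert b {..<a}" "a < b" "b < j"
        | a where "S' = insert j {..<a}" "j - m \<le> a"
        unfolding Qc_def Q_def F_def by (auto simp del: insert_iff)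
      then show "i \<in> S'"
      proof cases
        case 1
        then show ?thesis using S'(2) i(1) by simp
      next
        case 2
        then show ?thesis using S'(2) by simp
      next
        case 3
        then show ?thesis using i(2) by simp
      qed
    qed (use i(1) that(1) in simp_all)
    moreover have "insert (insert j {..<i}) (Qc j m) = Qc j (Suc m)"
    proof -
      have "{j - Suc m..<j} = insert i {j - m..<j}" unfolding i_def[symmetric] i(2) using i(1) by auto
      then show ?thesis unfolding Qc_def by simp
    qed
    ultimately show ?case using Suc by auto
  qed
  have Q: "(?st ^^ (\<Sum>l<j. l)) (flag_stab (Q 0)) (flag_stab (Q j))" if "j \<le> d" for j
    using that
  proof (induction j)
    case (Suc j)
    have "Qc j j = Q (Suc j)" unfolding Qc_def Q_def by (simp add: lessThan_Suc atLeast0LessThan Un_ac)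
    then have "(?st ^^ j) (flag_stab (Q j)) (flag_stab (Q (Suc j)))" using col[of j j] Suc.prems by simp
    then have "((?st ^^ (\<Sum>l<j. l)) OO (?st ^^ j)) (flag_stab (Q 0)) (flag_stab (Q (Suc j)))"
      using Suc by (auto simp: OO_def)
    then show ?case by (simp add: relpowp_add)
  qed simp
  have "Q 0 = F (d - 1)" unfolding Q_def by auto
  then have "((?st ^^ (d - 1)) OO (?st ^^ (\<Sum>l<d. l))) (AGL d p) (flag_stab (Q d))"
    using F[of "d - 1"] Q[of d] by (auto simp: OO_def)
  moreover have "(\<Sum>l<d. l) = d * (d - 1) div 2"
    using Sum_Ico_nat[of 0 d] by (simp add: atLeast0LessThan)
  moreover have "flag_stab (Q d) = diag"
  proof (rule flag_stab_eq_diag)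
    fix j assume j: "j < d"
    show "{j} \<in> Q d"
    proof (cases "j = 0")
      case True
      have "{j} = {..<1}" using True by auto
      \<comment> \<open>This is where \<open>d \<ge> 2\<close> matters: axis 0 is the first member
        of the flag, which is empty for \<open>d = 1\<close>.\<close>
      then have "{j} \<in> F (d - 1)" unfolding F_def using d2 by force
      then show ?thesis unfolding Q_def by blast
    next
      case False
      have "{j} = insert j {..<0}" by auto
      then have "{j} \<in> (\<lambda>a. insert j {..<a}) ` {..<j}" using False by blast
      then show ?thesis unfolding Q_def using j by blast
    qed
  qed
  ultimately show ?thesis by (simp add: relpowp_add)
qed

section \<open>From the diagonal group to the trivial group\<close>

lemma element_of_order:
  assumes "k dvd p - 1"
  obtains c where "coprime p c" "c < p" "c \<noteq> 0" "ord p c = k"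
proof -
  obtain w where w: "coprime p w" "w < p" "w \<noteq> 0" "ord p w = p - 1" using primitive_root by blast
  obtain m where m: "p - 1 = k * m" using assms by blast
  have mk: "m > 0" "k > 0" using m p_gt_2 by (auto intro!: Nat.gr0I)
  define c where "c = w ^ m mod p"
  have "ord p c = ord p (w ^ m)" unfolding c_def by simp
  also have "\<dots> = k" using ord_power[OF w(1), of m] w(4) m mk by simp
  finally have o: "ord p c = k" .
  then have cop: "coprime p c" using mk by (metis ord_eq_0 neq0_conv)
  have "c < p" unfolding c_def by simp
  moreover have "c \<noteq> 0" using cop p_gt_2 by (cases "c = 0") auto
  ultimately show thesis using that cop o by blast
qed

lemma minus_one_squared: "[(p - 1) * (p - 1) = 1] (mod p)"
proof -
  obtain q where q: "p = q + 2" using p_gt_2 by (metis add.commute le_add_diff_inverse less_imp_le)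
  have "(p - 1) * (p - 1) = 1 + q * p" unfolding q by (simp add: algebra_simps)
  then show ?thesis unfolding cong_def by (simp only: mod_mult_self1)
qed

lemma small_transpose:
  assumes "p ^ d \<ge> 7" "x \<in> V" "y \<in> V"
  shows "small (transpose x y)"
  unfolding small_def
proof
  show "transpose x y permutes V" using assms by (simp add: permutes_swap_id)
  have "{z. transpose x y z \<noteq> z} \<subseteq> {x, y}" by (auto simp: transpose_def)
  then have "card {z. transpose x y z \<noteq> z} \<le> card {x, y}" by (intro card_mono) auto
  also have "\<dots> \<le> 2" by (simp add: card_insert_if)
  finally have "card {z. transpose x y z \<noteq> z} \<le> 2" .
  \<comment> \<open>For \<open>d = 1\<close> the left side is \<open>p - 1\<close>, and
    \<open>p = 5\<close> would give only equality; for \<open>d \<ge> 2\<close> it is at least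
    \<open>2 * 3\<close>.\<close>
  moreover have "p ^ d - p ^ (d - 1) > 4"
  proof -
    have e: "p ^ d = p * p ^ (d - 1)" using d_pos by (simp add: power_eq_if)
    show ?thesis
    proof (cases "d = 1")
      case False
      then have "p ^ 1 \<le> p ^ (d - 1)" using p_gt_2 d_pos by (intro power_increasing) auto
      then have "p ^ (d - 1) \<ge> 3" using p_gt_2 by simp
      moreover have "3 * p ^ (d - 1) \<le> p * p ^ (d - 1)" using p_gt_2 by (intro mult_le_mono) auto
      ultimately show ?thesis using e by linarith
    qed (use assms in simp)
  qed
  ultimately show "2 * card {z. transpose x y z \<noteq> z} < p ^ d - p ^ (d - 1)" by linarith
qed

lemma diag_AGL: "f \<in> diag \<Longrightarrow> f \<in> AGL d p" and diag_zero: "f \<in> diag \<Longrightarrow> f zero_vec = zero_vec"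
  unfolding diag_def by auto

lemma smul_unit_vec: "c < p \<Longrightarrow> smul c (unit_vec i) = (\<lambda>j. if j = i then c else 0)"
  unfolding smul_def unit_vec_def by auto

lemma diag_unit_vec:
  assumes "f \<in> diag" "i < d"
  shows "f (unit_vec i) = smul (f (unit_vec i) i) (unit_vec i)"
  unfolding smul_unit_vec[OF diag_entry(1)[OF assms]] using assms unfolding diag_def by auto

text \<open>Each \<open>g\<close> singles out a figure on axis \<open>i\<close> that a diagonal map
  preserves iff its entry is a \<open>k\<close>-th root of unity: the pair of 0 and
  \<open>unit_vec i\<close>, the pair of \<open>unit_vec i\<close> and its negative, or the set
  \<open>T\<close>. In the last case \<open>g\<close> moves \<open>k\<close> points, possibly too
  many for the commutator criterion, so non-commuting maps have to be excluded by hand.\<close>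

lemma torus_conj:
  assumes big: "p ^ d \<ge> 7" and i: "i < d" and k: "k dvd p - 1"
  shows "\<exists>g\<in>Sym V. \<forall>f\<in>diag. f \<in> conj_stab V (AGL d p) g \<longleftrightarrow> [f (unit_vec i) i ^ k = 1] (mod p)"
proof -
  let ?e = "unit_vec i"
  have eV: "?e \<in> V" using unit_vec_in i by blast
  have k0: "k > 0" using k p_gt_2 by (auto intro!: Nat.gr0I)
  have bij: "bij f" if "f \<in> diag" for f using AGL_permutes[OF diag_AGL[OF that]] permutes_bij by blast
  consider "k = 1" | "k = 2" | "k \<ge> 3" using k0 by linarith
  then show ?thesis
  proof cases
    case 1
    have zne: "zero_vec \<noteq> ?e" unfolding zero_vec_def unit_vec_def by (metis zero_neq_one)
    have sm: "small (transpose zero_vec ?e)" using small_transpose[OF big zero_vec_in eV] .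
    have "f \<in> conj_stab V (AGL d p) (transpose zero_vec ?e) \<longleftrightarrow> [f ?e i ^ k = 1] (mod p)" if f: "f \<in> diag" for f
    proof -
      have "transpose zero_vec ?e \<circ> f = f \<circ> transpose zero_vec ?e \<longleftrightarrow> f ?e = ?e"
      proof
        assume "transpose zero_vec ?e \<circ> f = f \<circ> transpose zero_vec ?e"
        from fun_cong[OF this, of zero_vec] show "f ?e = ?e" using diag_zero[OF f] by simp
      qed (use transpose_commute_fixes[OF bij[OF f] diag_zero[OF f]] in blast)
      also have "\<dots> \<longleftrightarrow> f ?e i = 1"
      proof
        assume "f ?e i = 1"
        then have "f ?e = smul 1 ?e" using diag_unit_vec[OF f i] by simp
        then show "f ?e = ?e" using smul_unit_vec[of 1 i] p_gt_2 by (auto simp: unit_vec_def)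
      qed (simp add: unit_vec_def)
      also have "\<dots> \<longleftrightarrow> [f ?e i ^ k = 1] (mod p)"
        using diag_entry[OF f i] p_gt_2 1 by (auto simp: cong_def)
      finally show ?thesis using conj_stab_small_iff[OF sm diag_AGL[OF f]] by simp
    qed
    then show ?thesis using sm unfolding small_def Sym_def by blast
  next
    case 2
    let ?m = "smul (p - 1) ?e"
    have mV: "?m \<in> V" using smul_in eV by blast
    have m: "?m = (\<lambda>j. if j = i then p - 1 else 0)" using smul_unit_vec[of "p - 1" i] p_gt_2 by simp
    have ne: "?e \<noteq> ?m" 
    proof
      assume "?e = ?m"
      from fun_cong[OF this, of i] show False using p_gt_2 by (simp add: smul_def unit_vec_def)
    qed
    have sm: "small (transpose ?e ?m)" using small_transpose[OF big eV mV] .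
    have mm: "smul (p - 1) ?m = ?e"
    proof -
      have "((p - 1) * (p - 1)) mod p = 1" using minus_one_squared p_gt_2 by (simp add: cong_def)
      then show ?thesis unfolding m unfolding smul_def unit_vec_def by auto
    qed
    have "f \<in> conj_stab V (AGL d p) (transpose ?e ?m) \<longleftrightarrow> [f ?e i ^ k = 1] (mod p)" if f: "f \<in> diag" for f
    proof -
      have fm: "f ?m = smul (p - 1) (f ?e)" using AGL_smul[OF diag_AGL[OF f] diag_zero[OF f] eV] .
      have "transpose ?e ?m \<circ> f = f \<circ> transpose ?e ?m \<longleftrightarrow> f ?e = ?e \<or> f ?e = ?m"
      proof
        assume "f ?e = ?e \<or> f ?e = ?m"
        then show "transpose ?e ?m \<circ> f = f \<circ> transpose ?e ?m"
          using transpose_commute_fixes[OF bij[OF f], of ?e ?m] transpose_commute_swaps[OF bij[OF f], of ?e ?m]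
            fm mm by auto
      qed (use transpose_commute_imp[OF bij[OF f] _ ne] in blast)
      also have "\<dots> \<longleftrightarrow> f ?e i = 1 \<or> f ?e i = p - 1"
      proof
        assume "f ?e i = 1 \<or> f ?e i = p - 1"
        then have "f ?e = smul 1 ?e \<or> f ?e = ?m" using diag_unit_vec[OF f i] by metis
        then show "f ?e = ?e \<or> f ?e = ?m" using smul_unit_vec[of 1 i] p_gt_2 by (auto simp: unit_vec_def)
      next
        assume "f ?e = ?e \<or> f ?e = ?m"
        then show "f ?e i = 1 \<or> f ?e i = p - 1" using m by (auto simp: unit_vec_def)
      qed
      also have "\<dots> \<longleftrightarrow> [f ?e i ^ k = 1] (mod p)"
      proof -
        let ?a = "f ?e i"
        have a: "0 < ?a" "?a < p" using diag_entry[OF f i] by auto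
        have "[?a ^ k = 1] (mod p) \<longleftrightarrow> [int (?a ^ k) = int 1] (mod int p)" by (rule cong_int_iff[symmetric])
        also have "\<dots> \<longleftrightarrow> int p dvd (int ?a - 1) * (int ?a + 1)"
          using 2 by (simp add: cong_iff_dvd_diff power2_eq_square algebra_simps)
        also have "\<dots> \<longleftrightarrow> int p dvd int ?a - 1 \<or> int p dvd int ?a + 1"
          using prime_p by (simp add: prime_dvd_mult_iff)
        also have "\<dots> \<longleftrightarrow> ?a = 1 \<or> ?a = p - 1"
        proof -
          have "int p dvd int ?a - 1 \<longleftrightarrow> ?a = 1"
          proof
            assume "int p dvd int ?a - 1"
            then have "int ?a - 1 = 0" using a zdvd_not_zless[of "int ?a - 1" "int p"] by linarith
            then show "?a = 1" by simp
          qed simp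
          moreover have "int p dvd int ?a + 1 \<longleftrightarrow> ?a = p - 1"
          proof
            assume "int p dvd int ?a + 1"
            then have "int p \<le> int ?a + 1" using a zdvd_imp_le by fastforce
            then show "?a = p - 1" using a by linarith
          next
            assume "?a = p - 1"
            then have "int ?a + 1 = int p" using a by linarith
            then show "int p dvd int ?a + 1" by simp
          qed
          ultimately show ?thesis by blast
        qed
        finally show ?thesis by blast
      qed
      finally show ?thesis using conj_stab_small_iff[OF sm diag_AGL[OF f]] by simp
    qed
    then show ?thesis using sm unfolding small_def Sym_def by blast
  next
    case 3
    obtain c where c: "coprime p c" "c < p" "c \<noteq> 0" "ord p c = k" using element_of_order[OF k] by blast
    define T where "T = {x \<in> coord_subspace {i}. [x i ^ k = 1] (mod p)}"
    define g where "g = scale_on T c"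
    have TV: "T \<subseteq> V" unfolding T_def coord_subspace_def by blast
    have ck: "[c ^ k = 1] (mod p)" using ord[of c p] c(4) by simp
    have pw: "[(a * b mod p) ^ k = b ^ k] (mod p)" if "[a ^ k = 1] (mod p)" for a b
    proof -
      have "[(a * b mod p) ^ k = (a * b) ^ k] (mod p)" by (simp add: cong_def power_mod)
      also have "(a * b) ^ k = a ^ k * b ^ k" by (simp add: power_mult_distrib)
      also have "[a ^ k * b ^ k = 1 * b ^ k] (mod p)" by (intro cong_mult that cong_refl)
      finally show ?thesis by simp
    qed
    have gp: "g permutes V" unfolding g_def
    proof (rule scale_on_permutes[OF TV _ c(2,3)])
      fix x assume x: "x \<in> T"
      have "[(c * x i mod p) ^ k = 1] (mod p)" using pw[OF ck, of "x i"] x unfolding T_def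
        by (blast intro: cong_trans)
      then show "smul c x \<in> T" using x smul_coord_subspace unfolding T_def by (simp add: smul_def)
    qed
    have eT: "?e \<in> T" unfolding T_def coord_subspace_def using eV by (auto simp: unit_vec_def)
    have "f \<in> conj_stab V (AGL d p) g \<longleftrightarrow> [f ?e i ^ k = 1] (mod p)" if f: "f \<in> diag" for f
    proof
      let ?a = "f ?e i"
      note fA = diag_AGL[OF f] and f0 = diag_zero[OF f]
      note fp = AGL_permutes[OF fA]
      {
        assume a: "[?a ^ k = 1] (mod p)"
        have "g \<circ> f = f \<circ> g" unfolding g_def
        proof (rule scale_on_commute[OF fA f0 TV])
          fix x assume x: "x \<in> V"
          have "[f x i ^ k = x i ^ k] (mod p)" using pw[OF a, of "x i"] diag_apply[OF f x, of i] by simp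
          then have "[f x i ^ k = 1] (mod p) \<longleftrightarrow> [x i ^ k = 1] (mod p)" by (simp add: cong_def)
          then show "f x \<in> T \<longleftrightarrow> x \<in> T" unfolding T_def using diag_coord_subspace[OF f x] by simp
        qed
        then have "g \<circ> f \<circ> inv g = f" using perm_comp_cancel(3)[OF gp] by simp
        then show "f \<in> conj_stab V (AGL d p) g" unfolding conj_stab_def Sym_def using fp fA by simp
      next
        assume "f \<in> conj_stab V (AGL d p) g"
        then have hA: "g \<circ> f \<circ> inv g \<in> AGL d p" unfolding conj_stab_def by blast
        define h where "h = g \<circ> f \<circ> inv g"
        have hg: "h (g x) = g (f x)" for x unfolding h_def using permutes_inverses[OF gp] by simp
        show "[?a ^ k = 1] (mod p)"
        proof (rule ccontr)
          \<comment> \<open>Write \<open>e\<close> for the unit vector and \<open>a\<close> for the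
            entry. Neither \<open>f e = a e\<close> nor the preimage \<open>x\<close> of
            \<open>e\<close> under \<open>f\<close> lies in \<open>T\<close>, so \<open>g\<close>
            fixes both, while it sends \<open>e\<close> to \<open>c e\<close>. Hence
            \<open>h\<close> takes \<open>c e\<close> to \<open>a e\<close> and \<open>x\<close> to
            \<open>c e\<close>. Comparing both with \<open>u\<close>, the coordinate of
            \<open>h e\<close>, gives \<open>c u = a\<close> and \<open>u = a c\<close>, thus
            \<open>c ^ 2 = 1\<close>.\<close>
          assume na: "\<not> [?a ^ k = 1] (mod p)"
          have "g zero_vec = zero_vec" unfolding g_def scale_on_def smul_def zero_vec_def by simp
          then have h0: "h zero_vec = zero_vec" using hg[of zero_vec] f0 by simp
          define x where "x = inv f ?e"
          have fx: "f x = ?e" unfolding x_def using permutes_inverses[OF fp] by simp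
          have xV: "x \<in> V" unfolding x_def using permutes_in[OF permutes_inv[OF fp] eV] .
          have xi: "?a * x i mod p = 1" using diag_apply[OF f xV, of i] fx by (simp add: unit_vec_def)
          have xu: "x = smul (x i) ?e"
          proof
            fix j show "x j = smul (x i) ?e j"
              using diag_eq_0_iff[OF f xV, of j] fx Vec_less[OF xV, of i] by (auto simp: unit_vec_def smul_def)
          qed
          have "f ?e \<notin> T" using na unfolding T_def by blast
          then have "h (smul c ?e) = f ?e" using hg[of ?e] eT unfolding g_def scale_on_def by simp
          then have h1: "smul c (h ?e) = f ?e" using AGL_smul[OF hA[folded h_def] h0 eV] by simp
          have "x \<notin> T"
          proof
            assume "x \<in> T"
            then have x1: "[x i ^ k = 1] (mod p)" unfolding T_def by blast
            have "[(?a * x i mod p) ^ k = ?a ^ k] (mod p)" using pw[OF x1, of ?a] by (simp add: mult.commute)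
            then show False using na xi by (simp add: cong_sym_eq)
          qed
          then have "h x = smul c ?e" using hg[of x] fx eT unfolding g_def scale_on_def by simp
          then have h2: "smul (x i) (h ?e) = smul c ?e" using AGL_smul[OF hA[folded h_def] h0 eV] xu by metis
          define u where "u = h ?e i"
          have c1: "[c * u = ?a] (mod p)" using fun_cong[OF h1, of i] diag_entry(1)[OF f i]
            unfolding u_def smul_def cong_def by simp
          have c2: "[x i * u = c] (mod p)" using fun_cong[OF h2, of i]
            unfolding u_def smul_def cong_def by (simp add: unit_vec_def)
          have "[c * c = c * (x i * u)] (mod p)" by (intro cong_mult cong_refl cong_sym[OF c2])
          also have "c * (x i * u) = c * u * x i" by simp
          also have "[c * u * x i = ?a * x i] (mod p)" by (intro cong_mult cong_refl c1)
          also have "[?a * x i = 1] (mod p)" using xi p_gt_2 by (simp add: cong_def)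
          finally have "[c ^ 2 = 1] (mod p)" by (simp add: power2_eq_square)
          then have "k dvd 2" using ord_divides[of c 2 p] c(4) by simp
          then show False using 3 by (auto dest: dvd_imp_le)
        qed
      }
    qed
    then show ?thesis using gp unfolding Sym_def by blast
  qed
qed

section \<open>Descent inside the diagonal group\<close>

definition torus :: "nat \<Rightarrow> ((nat \<Rightarrow> nat) \<Rightarrow> nat \<Rightarrow> nat) set" where
  "torus i = {f \<in> diag. \<forall>l<i. f (unit_vec l) = unit_vec l}"

lemma torus_witness:
  assumes "i < d" "c < p" "c \<noteq> 0"
  obtains f where "f \<in> torus i" "f (unit_vec i) i = c"
proof -
  let ?v = "smul c (unit_vec i)"
  let ?f = "colmap i ?v"
  have v: "?v = (\<lambda>j. if j = i then c else 0)" using smul_unit_vec assms by blast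
  have vV: "?v \<in> V" using smul_in unit_vec_in assms by blast
  have fi: "?f (unit_vec i) = ?v" using colmap_unit_vec[OF assms(1) vV] .
  have fj: "?f (unit_vec j) = unit_vec j" if "j \<noteq> i" for j
    using that by (intro colmap_fix) (simp add: unit_vec_def)
  have "?f \<in> AGL d p" using assms v vV by (intro colmap_AGL) auto
  moreover have "?f zero_vec = zero_vec" by (intro colmap_fix) (simp add: zero_vec_def)
  moreover have "?f (unit_vec j) l = 0" if "l \<noteq> j" for j l
    using fi fj[of j] v that by (cases "j = i") (auto simp: unit_vec_def)
  ultimately have "?f \<in> torus i" unfolding torus_def diag_def using fj by auto
  then show thesis using that fi v by simp
qed

text \<open>Removing a prime factor from \<open>n\<close> is one step, strict because an entry of
  exact order \<open>n\<close> exists. The end is written with exponent 1 so that it is the case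
  \<open>n = 1\<close> of the start.\<close>

lemma relpowp_torus_divisor:
  assumes big: "p ^ d \<ge> 7" and i: "i < d" and n: "n dvd p - 1"
  shows "(base_step V (AGL d p) (Sym V) ^^ bigOmega n)
    {f \<in> torus i. [f (unit_vec i) i ^ n = 1] (mod p)} {f \<in> torus i. [f (unit_vec i) i ^ 1 = 1] (mod p)}"
  using n
proof (induction n rule: less_induct)
  case (less n)
  show ?case
  proof (cases "n = 1")
    case False
    obtain q where q: "prime q" "q dvd n" using False prime_factor_nat by blast
    then obtain m where m: "n = q * m" by blast
    have n0: "n > 0" using less.prems p_gt_2 by (auto intro!: Nat.gr0I)
    then have m0: "m > 0" using m by (auto intro!: Nat.gr0I)
    have mn: "m < n" using m m0 q(1) prime_gt_1_nat by auto
    have mdvd: "m dvd p - 1" using m less.prems by (metis dvd_mult_right)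
    obtain g where g: "g \<in> Sym V"
      "\<And>f. f \<in> diag \<Longrightarrow> f \<in> conj_stab V (AGL d p) g \<longleftrightarrow> [f (unit_vec i) i ^ m = 1] (mod p)"
      using torus_conj[OF big i mdvd] by blast
    let ?X = "\<lambda>n. {f \<in> torus i. [f (unit_vec i) i ^ n = 1] (mod p)}"
    have sub: "[a ^ n = 1] (mod p)" if "[a ^ m = 1] (mod p)" for a
      using that m ord_divides[of a m p] ord_divides[of a n p] by (metis dvd_mult)
    have eq: "?X m = ?X n \<inter> conj_stab V (AGL d p) g"
      using sub g(2) unfolding torus_def by auto
    obtain c where c: "coprime p c" "c < p" "c \<noteq> 0" "ord p c = n" using element_of_order[OF less.prems] by blast
    obtain f where f: "f \<in> torus i" "f (unit_vec i) i = c" using torus_witness[OF i c(2,3)] by blast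
    have "[c ^ n = 1] (mod p)" using ord[of c p] c(4) by simp
    moreover have "\<not> [c ^ m = 1] (mod p)" using ord_minimal[of m p c] c(4) mn m0 by blast
    ultimately have "f \<in> ?X n" "f \<notin> ?X m" using f by auto
    then have "?X m \<subset> ?X n" using eq by blast
    then have "base_step V (AGL d p) (Sym V) (?X n) (?X m)" unfolding base_step_def using g(1) eq by blast
    moreover have "bigOmega n = Suc (bigOmega m)" using m m0 q(1)
      by (simp add: bigOmega_mult bigOmega_prime prime_gt_0_nat)
    ultimately show ?thesis using relpowp_Suc_I2[OF _ less.IH[OF mn mdvd]] by simp
  qed simp
qed

lemma relpowp_diag_id:
  assumes big: "p ^ d \<ge> 7"
  shows "(base_step V (AGL d p) (Sym V) ^^ (d * bigOmega (p - 1))) diag {id}"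
proof -
  let ?st = "base_step V (AGL d p) (Sym V)"
  have "(?st ^^ bigOmega (p - 1)) (torus i) (torus (Suc i))" if i: "i < d" for i
  proof -
    have "[f (unit_vec i) i ^ (p - 1) = 1] (mod p)" if "f \<in> torus i" for f
    proof (rule fermat_theorem[OF prime_p])
      have "f \<in> diag" using that unfolding torus_def by blast
      then show "\<not> p dvd f (unit_vec i) i"
        using diag_entry[OF _ i, of f] by (meson gr0I nat_dvd_not_less)
    qed
    then have 1: "{f \<in> torus i. [f (unit_vec i) i ^ (p - 1) = 1] (mod p)} = torus i" by blast
    have "[f (unit_vec i) i ^ 1 = 1] (mod p) \<longleftrightarrow> f (unit_vec i) = unit_vec i" if "f \<in> diag" for f
    proof
      assume "[f (unit_vec i) i ^ 1 = 1] (mod p)"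
      then have "f (unit_vec i) i = 1" using diag_entry(1)[OF that i] p_gt_2 by (simp add: cong_def)
      then show "f (unit_vec i) = unit_vec i"
        using diag_unit_vec[OF that i] smul_unit_vec[of 1 i] p_gt_2 by (auto simp: unit_vec_def)
    qed (simp add: unit_vec_def)
    then have 2: "{f \<in> torus i. [f (unit_vec i) i ^ 1 = 1] (mod p)} = torus (Suc i)"
      unfolding torus_def by (auto simp: less_Suc_eq)
    show ?thesis using relpowp_torus_divisor[OF big i dvd_refl] unfolding 1 2 .
  qed
  then have step: "(?st ^^ (i * bigOmega (p - 1))) (torus 0) (torus i)" if "i \<le> d" for i
    using that
  proof (induction i)
    case (Suc i)
    then have "((?st ^^ (i * bigOmega (p - 1))) OO (?st ^^ bigOmega (p - 1))) (torus 0) (torus (Suc i))"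
      by (auto simp: OO_def)
    then show ?case by (simp add: relpowp_add[symmetric] add.commute)
  qed simp
  have "torus 0 = diag" unfolding torus_def by simp
  moreover have "torus d = {id}"
  proof -
    have "torus d \<subseteq> frame_stab d" unfolding torus_def diag_def frame_stab_def by blast
    moreover have "id \<in> torus d"
      unfolding torus_def diag_def using perm_groupD(2)[OF AGL_group] by (simp add: unit_vec_def)
    ultimately show ?thesis unfolding frame_stab_full by blast
  qed
  ultimately show ?thesis using step[of d] by simp
qed

text \<open>The first point is the coset \<open>H\<close> itself. The step is strict because a
  transposition moves fewer points than a nontrivial affine map must.\<close>

lemma base_step_Sym_AGL:
  assumes big: "p ^ d \<ge> 7"
  shows "base_step V (AGL d p) (Sym V) (Sym V) (AGL d p)"
proof -
  let ?t = "transpose zero_vec (unit_vec 0)"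
  have sm: "small ?t" using small_transpose[OF big zero_vec_in unit_vec_in[OF d_pos]] .
  have "?t \<notin> AGL d p"
  proof
    assume A: "?t \<in> AGL d p"
    have "?t \<noteq> id" by (metis transpose_eq_id_iff zero_vec_def unit_vec_def zero_neq_one)
    then have "p ^ d - p ^ (d - 1) \<le> card {x. ?t x \<noteq> x}" using AGL_moved_points[OF A] by blast
    then show False using sm unfolding small_def by linarith
  qed
  moreover have "?t \<in> Sym V" using sm unfolding small_def Sym_def by blast
  ultimately have "AGL d p \<subset> Sym V" using AGL_group unfolding perm_group_def by blast
  moreover have "AGL d p = Sym V \<inter> conj_stab V (AGL d p) id"
    using conj_stab_id[OF AGL_group] AGL_group unfolding perm_group_def by blast
  moreover have "id \<in> Sym V" unfolding Sym_def by (simp add: permutes_id)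
  ultimately show ?thesis unfolding base_step_def by metis
qed

text \<open>One step into the affine group, \<open>d - 1\<close> for the flag and
  \<open>d * (d - 1) / 2\<close> for the entries above the diagonal add up to
  \<open>d * (d + 1) / 2\<close>; the rest takes place inside the diagonal group.\<close>

lemma relpowp_Sym_id:
  assumes "d \<ge> 2" "p ^ d \<ge> 7"
  shows "(base_step V (AGL d p) (Sym V) ^^ (d * (d + 1) div 2 + d * bigOmega (p - 1))) (Sym V) {id}"
proof -
  let ?st = "base_step V (AGL d p) (Sym V)"
  have "((?st ^^ (d - 1 + d * (d - 1) div 2)) OO (?st ^^ (d * bigOmega (p - 1)))) (AGL d p) {id}"
    using relpowp_AGL_diag[OF assms(1)] relpowp_diag_id[OF assms(2)] by (auto simp: OO_def)
  then have "(?st ^^ (d - 1 + d * (d - 1) div 2 + d * bigOmega (p - 1))) (AGL d p) {id}"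
    by (simp only: relpowp_add)
  then have "(?st ^^ Suc (d - 1 + d * (d - 1) div 2 + d * bigOmega (p - 1))) (Sym V) {id}"
    by (rule relpowp_Suc_I2[of ?st, OF base_step_Sym_AGL[OF assms(2)]])
  moreover have "d * (d + 1) div 2 = d + d * (d - 1) div 2"
  proof -
    have "d * (d + 1) = 2 * d + d * (d - 1)" using d_pos by (cases d) auto
    then show ?thesis by simp
  qed
  ultimately show ?thesis using d_pos by (simp del: relpowp.simps)
qed

section \<open>Dimension one\<close>

definition inversion :: "(nat \<Rightarrow> nat) \<Rightarrow> nat \<Rightarrow> nat" where
  "inversion x = (if x \<in> V then (\<lambda>i. x i ^ (p - 2) mod p) else x)"

text \<open>By Fermat the power \<open>p - 2\<close> is the inverse of a nonzero residue. Hence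
  \<open>inversion\<close> inverts each nonzero coordinate and, the exponent being positive, keeps
  zero coordinates.\<close>

lemma power_p_minus_2:
  assumes "0 < a" "a < p"
  shows "[a * (a ^ (p - 2) mod p) = 1] (mod p)"
proof -
  have "[a * (a ^ (p - 2) mod p) = a * a ^ (p - 2)] (mod p)" by (simp add: cong_def mod_mult_right_eq)
  also have "a * a ^ (p - 2) = a ^ (p - 1)" using p_gt_2
    by (metis Suc_diff_Suc diff_Suc_1 numeral_2_eq_2 One_nat_def Suc_lessD power_Suc)
  also have "[a ^ (p - 1) = 1] (mod p)"
    using fermat_theorem[OF prime_p] assms nat_dvd_not_less by blast
  finally show ?thesis .
qed

lemma inversion_in: "x \<in> V \<Longrightarrow> inversion x \<in> V"
  unfolding inversion_def using p_gt_2 by (auto intro!: VecI simp: Vec_0 power_0_left)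

lemma inversion_permutes: "inversion permutes V"
proof (rule inj_imp_permutes[OF _ finite_V])
  show "inj_on inversion V"
  proof (rule inj_onI)
    fix x y assume xy: "x \<in> V" "y \<in> V" "inversion x = inversion y"
    have e: "x i ^ (p - 2) mod p = y i ^ (p - 2) mod p" for i
      using fun_cong[OF xy(3), of i] xy unfolding inversion_def by simp
    have z: "a ^ (p - 2) mod p = 0 \<longleftrightarrow> a = 0" if "a < p" for a
      using power_p_minus_2[of a] that p_gt_2 by (cases "a = 0") (auto simp: cong_def power_0_left intro!: Nat.gr0I)
    show "x = y"
    proof
      fix i
      show "x i = y i"
      proof (cases "x i = 0 \<or> y i = 0")
        case True
        then show ?thesis using e[of i] z Vec_less xy by metis
      next
        case False
        let ?u = "x i ^ (p - 2) mod p"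
        have x1: "[x i * ?u = 1] (mod p)" and y1: "[y i * ?u = 1] (mod p)"
          using power_p_minus_2 False Vec_less xy e[of i] by (metis neq0_conv)+
        have "[x i * 1 = x i * (y i * ?u)] (mod p)" by (intro cong_mult cong_refl cong_sym[OF y1])
        also have "x i * (y i * ?u) = y i * (x i * ?u)" by simp
        also have "[y i * (x i * ?u) = y i * 1] (mod p)" by (intro cong_mult cong_refl x1)
        finally show ?thesis using Vec_less[OF xy(1), of i] Vec_less[OF xy(2), of i]
          by (simp add: cong_less_modulus_unique_nat)
      qed
    qed
  qed
qed (use inversion_in in \<open>auto simp: inversion_def\<close>)

text \<open>Inversion is multiplicative, so it conjugates multiplication by a scalar to
  multiplication by the inverse scalar, in each coordinate separately.\<close>

lemma diag_conj_inversion: "diag \<subseteq> conj_stab V (AGL d p) inversion"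
proof
  fix f assume f: "f \<in> diag"
  let ?h = "inversion \<circ> f \<circ> inv inversion"
  note fA = diag_AGL[OF f]
  note fp = AGL_permutes[OF fA]
  have ip: "inv inversion permutes V" using inversion_permutes permutes_inv by blast
  have hp: "?h permutes V" using fp inversion_permutes ip by (intro permutes_compose)
  define a where "a i = f (unit_vec i) i ^ (p - 2)" for i
  have h: "?h x i = (a i * x i) mod p" if x: "x \<in> V" for x i
  proof -
    define y where "y = inv inversion x"
    have yV: "y \<in> V" unfolding y_def using permutes_in[OF ip x] .
    have xy: "x = inversion y" unfolding y_def using permutes_inverses[OF inversion_permutes] by simp
    have "?h x i = f y i ^ (p - 2) mod p"
      unfolding comp_apply y_def[symmetric] using permutes_in[OF fp yV] by (simp add: inversion_def)
    also have "\<dots> = (f (unit_vec i) i * y i) ^ (p - 2) mod p"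
      unfolding diag_apply[OF f yV, of i] by (simp add: power_mod)
    also have "\<dots> = (a i * (y i ^ (p - 2) mod p)) mod p"
      unfolding a_def by (simp add: power_mult_distrib mod_mult_right_eq)
    also have "y i ^ (p - 2) mod p = x i" using xy yV by (simp add: inversion_def)
    finally show ?thesis .
  qed
  have hc: "[int (?h x i) = int (a i) * int (x i)] (mod int p)" if "x \<in> V" for x i
    using h[OF that, of i] by (simp add: cong_def zmod_int)
  have "?h \<in> AGL d p"
  proof (rule AGL_I[OF hp])
    fix x y z assume v: "x \<in> V" "y \<in> V" "z \<in> V"
    show "?h (shift x 1 y z) = shift (?h x) 1 (?h y) (?h z)"
    proof (rule Vec_eqI)
      show "?h (shift x 1 y z) \<in> V" "shift (?h x) 1 (?h y) (?h z) \<in> V"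
        using permutes_in[OF hp] shift_in v by blast+
      fix i
      have "[int (?h (shift x 1 y z) i) = int (a i) * int (shift x 1 y z i)] (mod int p)"
        using hc shift_in v by blast
      also have "[int (a i) * int (shift x 1 y z i) =
          int (a i) * (int (x i) + int 1 * (int (z i) - int (y i)))] (mod int p)"
        by (intro cong_mult cong_refl shift_cong v)
      also have "int (a i) * (int (x i) + int 1 * (int (z i) - int (y i))) =
          int (a i) * int (x i) + int 1 * (int (a i) * int (z i) - int (a i) * int (y i))"
        by (simp add: algebra_simps)
      also have "[int (a i) * int (x i) + int 1 * (int (a i) * int (z i) - int (a i) * int (y i)) =
          int (?h x i) + int 1 * (int (?h z i) - int (?h y i))] (mod int p)"
        by (intro cong_add cong_mult cong_diff cong_refl cong_sym[OF hc] v)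
      also have "[int (?h x i) + int 1 * (int (?h z i) - int (?h y i)) =
          int (shift (?h x) 1 (?h y) (?h z) i)] (mod int p)"
        by (rule cong_sym, rule shift_cong) (rule permutes_in[OF hp v(2)])
      finally show "[int (?h (shift x 1 y z) i) = int (shift (?h x) 1 (?h y) (?h z) i)] (mod int p)" .
    qed
  qed
  then show "f \<in> conj_stab V (AGL d p) inversion" unfolding conj_stab_def Sym_def using fp by simp
qed

text \<open>The conjugate is evaluated at 0, \<open>unit_vec 0\<close> and its negative, all fixed
  by inversion. The translation takes them to 1, 2 and 0 in coordinate 0, where inversion alters
  only the 2.\<close>

lemma transl_not_conj_inversion:
  assumes "p \<ge> 7"
  shows "transl (unit_vec 0) \<notin> conj_stab V (AGL d p) inversion"
proof
  let ?e = "unit_vec 0"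
  assume "transl ?e \<in> conj_stab V (AGL d p) inversion"
  then have hA: "inversion \<circ> transl ?e \<circ> inv inversion \<in> AGL d p" unfolding conj_stab_def by blast
  define h where "h = inversion \<circ> transl ?e \<circ> inv inversion"
  have hg: "h (inversion x) = inversion (transl ?e x)" for x
    unfolding h_def using permutes_inverses[OF inversion_permutes] by simp
  have eV: "?e \<in> V" using unit_vec_in d_pos by blast
  let ?m = "smul (p - 1) ?e"
  have mV: "?m \<in> V" using smul_in eV by blast
  have m: "?m = (\<lambda>j. if j = 0 then p - 1 else 0)" using smul_unit_vec[of "p - 1" 0] p_gt_2 by simp
  have p2: "p - 2 > 0" using p_gt_2 by simp
  have i0: "inversion zero_vec = zero_vec"
    using p2 by (auto simp: inversion_def zero_vec_def fun_eq_iff power_0_left)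
  have ie: "inversion ?e = ?e"
    using p2 p_gt_2 eV by (auto simp: inversion_def unit_vec_def fun_eq_iff power_0_left)
  have te: "transl ?e ?e = smul 2 ?e"
    unfolding transl_def shift_def smul_def zero_vec_def using eV mod_add_self2[of 2 p]
    by (auto simp: unit_vec_def fun_eq_iff)
  have sV: "smul 2 ?e \<in> V" using smul_in eV by blast
  have s: "smul 2 ?e 0 = 2" using p_gt_2 by (simp add: smul_def unit_vec_def)
  have h0: "h zero_vec = ?e" using hg[of zero_vec] i0 transl_zero[OF eV] ie by simp
  have h1: "h ?e = inversion (smul 2 ?e)" using hg[of ?e] ie te by simp
  \<comment> \<open>in one coordinate h 0 = 1, h 1 = 1/2 and h (-1) = 0, so an affine h would give 3/2 = 0\<close>
  define b where "b = h ?e 0"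
  have b: "[2 * b = 1] (mod p)"
    using power_p_minus_2[of 2] p_gt_2 h1 sV s unfolding b_def by (simp add: inversion_def)
  have im: "inversion ?m = ?m"
  proof -
    define u where "u = (p - 1) ^ (p - 2) mod p"
    have "[(p - 1) * u = 1] (mod p)" unfolding u_def using power_p_minus_2[of "p - 1"] p_gt_2 by simp
    from cong_mult[OF cong_refl[of "p - 1"] this]
    have A: "[(p - 1) * (p - 1) * u = p - 1] (mod p)" by (simp only: mult.assoc mult_1_right)
    from cong_mult[OF minus_one_squared cong_refl[of u]]
    have B: "[(p - 1) * (p - 1) * u = u] (mod p)" by (simp only: mult_1)
    have "[(p - 1) ^ (p - 2) mod p = p - 1] (mod p)"
      using cong_trans[OF cong_sym[OF B] A] unfolding u_def .
    then have "(p - 1) ^ (p - 2) mod p = p - 1" using p_gt_2 by (simp add: cong_def)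
    then show ?thesis using mV p2 unfolding inversion_def m by (auto simp: fun_eq_iff power_0_left)
  qed
  have "transl ?e ?m = zero_vec"
    unfolding transl_def shift_def using mV p_gt_2 unfolding m zero_vec_def by (auto simp: unit_vec_def fun_eq_iff)
  then have hm: "h ?m = zero_vec" using hg[of ?m] im i0 by simp
  have "h ?m = shift (h zero_vec) (p - 1) (h zero_vec) (h ?e)"
    unfolding smul_eq_shift using AGL_shift[OF hA[folded h_def] zero_vec_in zero_vec_in eV] .
  then have "[int (zero_vec 0) = int (?e 0) + int (p - 1) * (int b - int (?e 0))] (mod int p)"
    unfolding b_def using shift_cong[OF eV, of ?e "p - 1" "h ?e" 0] hm h0 by simp
  then have "[0 = 1 + (int p - 1) * (int b - 1)] (mod int p)"
    using p_gt_2 by (simp add: zero_vec_def unit_vec_def of_nat_diff)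
  then have d1: "int p dvd 2 - int b + int p * (int b - 1)"
    by (simp add: cong_iff_dvd_diff algebra_simps dvd_diff_commute)
  then have "int p dvd 2 - int b" by (simp add: dvd_add_left_iff)
  moreover have "int p dvd 2 * int b - 1"
    using b by (metis cong_iff_dvd_diff cong_int_iff of_nat_1 of_nat_mult of_nat_numeral)
  ultimately have "int p dvd 2 * (2 - int b) + (2 * int b - 1)" by (metis dvd_add dvd_mult)
  then have "int p dvd 3" by simp
  then show False using assms zdvd_imp_le[of "int p" 3] by simp
qed

text \<open>The group \<open>Y\<close> lies between the diagonal group of order \<open>p - 1\<close>
  and the affine group of order \<open>p * (p - 1)\<close>. The index is prime and a translation is
  missing from \<open>Y\<close>, so \<open>Y\<close> is the diagonal group.\<close>

lemma relpowp_Sym_id_dim_1: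
  assumes d1: "d = 1" and p7: "p \<ge> 7"
  shows "(base_step V (AGL d p) (Sym V) ^^ (2 + bigOmega (p - 1))) (Sym V) {id}"
proof -
  let ?st = "base_step V (AGL d p) (Sym V)"
  have big: "p ^ d \<ge> 7" using d1 p7 by simp
  \<comment> \<open>In dimension one every linear map is diagonal. This supplies both the group
    property and the order of \<open>diag\<close>.\<close>
  have diag: "diag = frame_stab 0"
    unfolding diag_def frame_stab_def using d1 Vec_0 AGL_in unit_vec_in by (auto simp: less_Suc_eq)
  have c0: "card (frame_stab 0) = p - 1"
    using card_frame_stab[of 0] frame_stab_full d1 by simp
  have cA: "card (AGL d p) = p * (p - 1)" unfolding card_AGL using d1 by simp
  define Y where "Y = AGL d p \<inter> conj_stab V (AGL d p) inversion"
  have pY: "perm_group V Y" unfolding Y_def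
    by (intro perm_group_Int AGL_group perm_group_conj_stab inversion_permutes)
  have DY: "diag \<subseteq> Y" unfolding Y_def using diag_AGL diag_conj_inversion by blast
  have tA: "transl (unit_vec 0) \<in> AGL d p" using transl_AGL unit_vec_in d_pos by blast
  have YA: "Y \<subset> AGL d p" using tA transl_not_conj_inversion[OF p7] unfolding Y_def by blast
  have finA: "finite (AGL d p)" using perm_group_finite[OF finite_V AGL_group] .
  have "Y = diag"
  proof -
    have "card (frame_stab 0) dvd card Y"
      using perm_group_lagrange[OF finite_V pY frame_stab_group] DY diag by simp
    then obtain m where m: "card Y = (p - 1) * m" unfolding c0 by blast
    have "card Y dvd card (AGL d p)" using perm_group_lagrange[OF finite_V AGL_group pY] YA by blast
    then have "(p - 1) * m dvd (p - 1) * p" unfolding cA m by (simp add: mult.commute)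
    then have "m dvd p" using p7 by simp
    then have "m = 1 \<or> m = p" using prime_p by (meson prime_nat_iff)
    moreover have "card Y < card (AGL d p)" using psubset_card_mono[OF finA YA] .
    ultimately have "card Y = card diag" using m cA c0 diag by (auto simp: mult.commute)
    then show ?thesis using DY YA finA by (metis card_subset_eq finite_subset psubset_imp_subset)
  qed
  then have "?st (AGL d p) diag" using YA inversion_permutes unfolding base_step_def Y_def Sym_def by blast
  moreover have "(?st ^^ bigOmega (p - 1)) diag {id}" using relpowp_diag_id[OF big] d1 by simp
  ultimately have "(?st ^^ Suc (bigOmega (p - 1))) (AGL d p) {id}" by (rule relpowp_Suc_I2)
  then have "(?st ^^ Suc (Suc (bigOmega (p - 1)))) (Sym V) {id}"
    by (rule relpowp_Suc_I2[of ?st, OF base_step_Sym_AGL[OF big]])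
  then show ?thesis by (simp del: relpowp.simps)
qed

end

theorem theorem5:
  fixes p d :: nat and G :: "((nat \<Rightarrow> nat) \<Rightarrow> (nat \<Rightarrow> nat)) set" and eps :: nat
  assumes "prime p" and "odd p" and "d > 0" and "p ^ d \<ge> 7"
    and "G = Sym (Vec p d) \<or> G = Alt (Vec p d)"
    and "eps = (if G = Sym (Vec p d) then 1 else 0)"
  defines "H \<equiv> AGL d p \<inter> G"
  shows "(d = 1 \<longrightarrow> I_base G H = 1 + bigOmega (p - 1) + eps)
    \<and> (d \<ge> 2 \<and> p \<in> {3, 5} \<longrightarrow>
         real (d * (d + 1) div 2 + d - 1 + eps) \<le> real (I_base G H)
       \<and> real (I_base G H) < real (d * (d + 1)) / 2 * (1 + log 2 (real p)) + real eps)
    \<and> (d \<ge> 2 \<and> p \<ge> 7 \<longrightarrow>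
         real (d * (d + 1) div 2 + d * bigOmega (p - 1) - 1 + eps) \<le> real (I_base G H)
       \<and> real (I_base G H) < real (d * (d + 1)) / 2 * (1 + log 2 (real p)) + real eps)"
proof -
  interpret odd_prime_space p d using assms by unfold_locales auto
  obtain h where h: "h \<in> AGL d p" "\<not> evenperm h" using odd_AGL by blast
  note bounds = I_base_bounds[OF finite_V AGL_group assms(5) h _ assms(6), folded H_def]
  have one: "I_base G H = 1 + bigOmega (p - 1) + eps" if d1: "d = 1"
  proof -
    \<comment> \<open>The order is \<open>p * (p - 1)\<close>, so the upper bound meets the lower
      bound \<open>2 + bigOmega (p - 1) - 1 + eps\<close>.\<close>
    have "bigOmega (card (AGL d p)) = 1 + bigOmega (p - 1)" unfolding bigOmega_card_AGL using d1 by simp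
    then show ?thesis using bounds[OF relpowp_Sym_id_dim_1[OF d1]] assms(4) d1 by simp
  qed
  have lower: "d * (d + 1) div 2 + d * bigOmega (p - 1) - 1 + eps \<le> I_base G H"
    and upper: "real (I_base G H) < real (d * (d + 1)) / 2 * (1 + log 2 (real p)) + real eps"
    if d2: "d \<ge> 2"
  proof -
    note b = bounds[OF relpowp_Sym_id[OF d2 assms(4)]]
    show "d * (d + 1) div 2 + d * bigOmega (p - 1) - 1 + eps \<le> I_base G H" using b(1) .
    have "real (I_base G H) \<le> real (bigOmega (card (AGL d p))) + real eps" using b(2) by linarith
    then show "real (I_base G H) < real (d * (d + 1)) / 2 * (1 + log 2 (real p)) + real eps"
      using bigOmega_card_AGL_less by linarith
  qed
  \<comment> \<open>The bound for \<open>p \<in> {3, 5}\<close> follows from the general one, since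
    \<open>p - 1\<close> has at least one prime factor.\<close>
  have "bigOmega (p - 1) > 0" using p_gt_2 by (intro bigOmega_pos) auto
  then have "d * 1 \<le> d * bigOmega (p - 1)" by (intro mult_le_mono) auto
  then have "d * (d + 1) div 2 + d - 1 + eps \<le> d * (d + 1) div 2 + d * bigOmega (p - 1) - 1 + eps" by linarith
  then have "d * (d + 1) div 2 + d - 1 + eps \<le> I_base G H" if "d \<ge> 2"
    using lower[OF that] by linarith
  then show ?thesis using one lower upper by (meson of_nat_le_iff)
qed

end
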